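(* Let $E$ be a finite set with $|E|=n$, and let $\mathbf{M}_1,\mathbf{M}_2$ be loopless matroids on $E$ with rank functions $r_1,r_2$. Suppose that the matroids are accessible only through an oracle which, given $X\subseteq E$, returns $r_{\min}(X)=\min\{r_1(X),r_2(X)\}$. Then a maximum-cardinality common independent set of $\mathbf{M}_1$ and $\mathbf{M}_2$ can be found in $O(rn^2)$ time (counting each oracle call as unit time), where $r$ is the maximum cardinality of a common independent set.
   Context: A common independent set is a set independent in both $\mathbf{M}_1$ and $\mathbf{M}_2$; equivalently, $I\subseteq E$ with $r_{\min}(I)=|I|$. *)

theory Defs
  imports Main
begin

section \<open>Matroids\<close>

locale matroid =
  fixes E :: "'a set" and indep :: "'a set \<Rightarrow> bool"
  assumes finite_ground: "finite E"
    and indep_subset_ground: "indep X \<Longrightarrow> X \<subseteq> E"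
    and indep_empty: "indep {}"
    and indep_subset: "indep X \<Longrightarrow> Y \<subseteq> X \<Longrightarrow> indep Y"
    and augment: "indep X \<Longrightarrow> indep Y \<Longrightarrow> card X < card Y
                    \<Longrightarrow> \<exists>y\<in>Y - X. indep (insert y X)"

definition loopless :: "'a set \<Rightarrow> ('a set \<Rightarrow> bool) \<Rightarrow> bool" where
  "loopless E indep \<longleftrightarrow> (\<forall>x\<in>E. indep {x})"

definition rank :: "('a set \<Rightarrow> bool) \<Rightarrow> 'a set \<Rightarrow> nat" where
  "rank indep X = Max {card I |I. I \<subseteq> X \<and> indep I}"

definition min_rank :: "('a set \<Rightarrow> bool) \<Rightarrow> ('a set \<Rightarrow> bool) \<Rightarrow> 'a set \<Rightarrow> nat" where
  "min_rank indep\<^sub>1 indep\<^sub>2 X = min (rank indep\<^sub>1 X) (rank indep\<^sub>2 X)"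

definition common_indep :: "('a set \<Rightarrow> bool) \<Rightarrow> ('a set \<Rightarrow> bool) \<Rightarrow> 'a set \<Rightarrow> bool" where
  "common_indep indep\<^sub>1 indep\<^sub>2 I \<longleftrightarrow> indep\<^sub>1 I \<and> indep\<^sub>2 I"

definition max_common_indep :: "('a set \<Rightarrow> bool) \<Rightarrow> ('a set \<Rightarrow> bool) \<Rightarrow> 'a set \<Rightarrow> bool" where
  "max_common_indep indep\<^sub>1 indep\<^sub>2 I \<longleftrightarrow>
     common_indep indep\<^sub>1 indep\<^sub>2 I \<and> (\<forall>J. common_indep indep\<^sub>1 indep\<^sub>2 J \<longrightarrow> card J \<le> card I)"

definition max_common_size :: "('a set \<Rightarrow> bool) \<Rightarrow> ('a set \<Rightarrow> bool) \<Rightarrow> nat" where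
  "max_common_size indep\<^sub>1 indep\<^sub>2 = Max {card I |I. common_indep indep\<^sub>1 indep\<^sub>2 I}"


section \<open>Oracle programs and their running time\<close>

text \<open>
  Algorithms are programs of a random access machine with an oracle, written in a small
  imperative language over registers and arrays of natural numbers. Each elementary operation
  and each oracle call takes one unit of time. The only arithmetic is successor and truncated
  subtraction, so after \<open>t\<close> steps every stored value is at most \<open>t\<close> plus the maximum of the
  initial values, the oracle answers and the constants of the program. The unit cost measure
  therefore hides no arithmetic on long numbers: in polynomially many steps, every machine word
  has \<open>O(log n)\<close> bits.
\<close>

record state =
  reg :: "nat \<Rightarrow> nat"
  arr :: "nat \<Rightarrow> nat \<Rightarrow> nat"

datatype aexp =
    Const nat
  | Reg nat
  | Arr nat aexp
  | Succ aexp
  | Minus aexp aexp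

datatype bexp =
    Less aexp aexp
  | Eq aexp aexp
  | Not bexp
  | And bexp bexp

datatype com =
    Skip
  | Assign nat aexp
  | Store nat aexp aexp
  | Query nat nat
  | Seq com com
  | If bexp com com
  | While bexp com

primrec aval :: "aexp \<Rightarrow> state \<Rightarrow> nat" where
  "aval (Const k) s = k"
| "aval (Reg x) s = reg s x"
| "aval (Arr a i) s = arr s a (aval i s)"
| "aval (Succ u) s = Suc (aval u s)"
| "aval (Minus u v) s = aval u s - aval v s"

primrec bval :: "bexp \<Rightarrow> state \<Rightarrow> bool" where
  "bval (Less u v) s \<longleftrightarrow> aval u s < aval v s"
| "bval (Eq u v) s \<longleftrightarrow> aval u s = aval v s"
| "bval (Not b) s \<longleftrightarrow> \<not> bval b s"
| "bval (And b b') s \<longleftrightarrow> bval b s \<and> bval b' s"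

primrec acost :: "aexp \<Rightarrow> nat" where
  "acost (Const k) = 1"
| "acost (Reg x) = 1"
| "acost (Arr a i) = 1 + acost i"
| "acost (Succ u) = 1 + acost u"
| "acost (Minus u v) = 1 + acost u + acost v"

primrec bcost :: "bexp \<Rightarrow> nat" where
  "bcost (Less u v) = 1 + acost u + acost v"
| "bcost (Eq u v) = 1 + acost u + acost v"
| "bcost (Not b) = 1 + bcost b"
| "bcost (And b b') = 1 + bcost b + bcost b'"

text \<open>
  \<open>exec f P s t s'\<close>: with oracle \<open>f\<close>, the program \<open>P\<close> started in \<open>s\<close> terminates in \<open>s'\<close> after
  \<open>t\<close> units of time. An oracle call reads its argument, a set of numbers, off an array that
  holds the characteristic vector of the set (nonzero entries are the members).
\<close>

inductive exec :: "(nat set \<Rightarrow> nat) \<Rightarrow> com \<Rightarrow> state \<Rightarrow> nat \<Rightarrow> state \<Rightarrow> bool"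
  for f :: "nat set \<Rightarrow> nat" where
  Skip: "exec f Skip s 1 s"
| Assign: "exec f (Assign x u) s (1 + acost u) (s\<lparr>reg := (reg s)(x := aval u s)\<rparr>)"
| Store: "exec f (Store a i u) s (1 + acost i + acost u)
            (s\<lparr>arr := (arr s)(a := (arr s a)(aval i s := aval u s))\<rparr>)"
| Query: "exec f (Query x a) s 1 (s\<lparr>reg := (reg s)(x := f {i. arr s a i \<noteq> 0})\<rparr>)"
| Seq: "exec f P s t s' \<Longrightarrow> exec f Q s' t' s'' \<Longrightarrow> exec f (Seq P Q) s (t + t') s''"
| IfTrue: "bval b s \<Longrightarrow> exec f P s t s' \<Longrightarrow> exec f (If b P Q) s (1 + bcost b + t) s'"
| IfFalse: "\<not> bval b s \<Longrightarrow> exec f Q s t s' \<Longrightarrow> exec f (If b P Q) s (1 + bcost b + t) s'"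
| WhileFalse: "\<not> bval b s \<Longrightarrow> exec f (While b P) s (1 + bcost b) s"
| WhileTrue: "bval b s \<Longrightarrow> exec f P s t s' \<Longrightarrow> exec f (While b P) s' t' s''
                \<Longrightarrow> exec f (While b P) s (1 + bcost b + t + t') s''"

text \<open>
  Only the size \<open>n\<close> of the ground set is given as input, in register \<open>0\<close>. The ground set is
  numbered by \<open>e\<close>, and a program sees the matroids only through the answers to sets of numbers
  below \<open>n\<close>; other numbers in a query are ignored. The result is read off array \<open>0\<close>.
\<close>

definition init_state :: "nat \<Rightarrow> state" where
  "init_state n = \<lparr>reg = (\<lambda>_. 0)(0 := n), arr = (\<lambda>_ _. 0)\<rparr>"

definition decode :: "(nat \<Rightarrow> 'a) \<Rightarrow> nat \<Rightarrow> nat set \<Rightarrow> 'a set" where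
  "decode e n X = e ` {i \<in> X. i < n}"

definition result_set :: "state \<Rightarrow> nat set" where
  "result_set s = {i. arr s 0 i \<noteq> 0}"

inductive_cases exec_elims:
  "exec f Skip s t s'"
  "exec f (Assign x u) s t s'"
  "exec f (Store a i u) s t s'"
  "exec f (Query x a) s t s'"
  "exec f (Seq P Q) s t s'"
  "exec f (If b P Q) s t s'"
  "exec f (While b P) s t s'"

lemma exec_deterministic:
  "exec f P s t s' \<Longrightarrow> exec f P s u s'' \<Longrightarrow> u = t \<and> s'' = s'"
proof (induction arbitrary: u s'' rule: exec.induct)
  case (Seq P s t s1 Q t' s2)
  from Seq.prems show ?case by (rule exec_elims(5)) (metis Seq.IH)
next
  case (IfTrue b s P t s1 Q)
  from IfTrue.prems show ?case by (rule exec_elims(6)) (use IfTrue in fastforce)+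
next
  case (IfFalse b s Q t s1 P)
  from IfFalse.prems show ?case by (rule exec_elims(6)) (use IfFalse in fastforce)+
next
  case (WhileFalse b s P)
  from WhileFalse.prems show ?case by (rule exec_elims(7)) (use WhileFalse in fastforce)+
next
  case (WhileTrue b s P t s1 t' s2)
  from WhileTrue.prems show ?case by (rule exec_elims(7)) (use WhileTrue in fastforce)+
qed (erule exec_elims, simp)+

end

theory Submission
  imports Defs
begin

text \<open>
  The program finds augmenting paths, although the oracle does not determine the exchange graph of
  a common independent set \<open>I\<close>, nor which of the two matroids is which. Suppose that \<open>I\<close> is maximal
  and \<open>k = |I|\<close>. A pair \<open>s, t\<close> with \<open>r\<^sub>m\<^sub>i\<^sub>n (I + s + t) = k + 1\<close> consists of a source \<open>s\<close> and a sink \<open>t\<close>,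
  up to exchanging the matroids; if there is none, one of the matroids is spanned by \<open>I\<close>. Adding \<open>t\<close>
  to a query makes the second rank large, so that the answer shows the first rank: \<open>x\<close> is a source
  iff \<open>r\<^sub>m\<^sub>i\<^sub>n (I + t + x) = k + 1\<close>, and if \<open>r\<^sub>m\<^sub>i\<^sub>n (I - y + t) < k\<close>, there is an arc \<open>y \<rightarrow> x\<close> iff
  \<open>r\<^sub>m\<^sub>i\<^sub>n (I - y + t + x) = k\<close>. If \<open>r\<^sub>m\<^sub>i\<^sub>n (I - y + t) = k\<close>, then \<open>y \<rightarrow> t\<close> is an arc, and the other arcs out of
  \<open>y\<close> are not needed on shortest paths. The same holds for \<open>s\<close> and the arcs into \<open>y\<close>. Breadth-first
  search in the resulting subgraph therefore finds a path without shortcuts in the full exchange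
  graph, or a set of reached vertices that certifies the optimality of \<open>I\<close>. Each of the at most
  \<open>r + 1\<close> phases takes \<open>O(n\<^sup>2)\<close> time.
\<close>

section \<open>Rank and span\<close>

context matroid
begin

lemma finite_indep: "indep X \<Longrightarrow> finite X"
  using finite_ground indep_subset_ground finite_subset by blast

lemma finite_indep_cards: "finite {card I |I. I \<subseteq> X \<and> indep I}"
proof (rule finite_subset)
  show "{card I |I. I \<subseteq> X \<and> indep I} \<subseteq> {..card E}"
    using card_mono[OF finite_ground] indep_subset_ground by auto
qed simp

lemma card_le_rank: "indep I \<Longrightarrow> I \<subseteq> X \<Longrightarrow> card I \<le> rank indep X"
  unfolding rank_def by (rule Max_ge[OF finite_indep_cards]) auto

lemma basis_exists: obtains B where "B \<subseteq> X" "indep B" "card B = rank indep X"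
proof -
  have "Max {card I |I. I \<subseteq> X \<and> indep I} \<in> {card I |I. I \<subseteq> X \<and> indep I}"
    by (rule Max_in[OF finite_indep_cards]) (use indep_empty in auto)
  then show thesis using that unfolding rank_def by auto
qed

lemma rank_mono: "X \<subseteq> Y \<Longrightarrow> rank indep X \<le> rank indep Y"
proof -
  assume "X \<subseteq> Y"
  moreover obtain B where "B \<subseteq> X" "indep B" "card B = rank indep X" by (rule basis_exists)
  ultimately show ?thesis using card_le_rank[of B Y] by auto
qed

lemma rank_le_insert: "rank indep X \<le> rank indep (insert x X)"
  by (intro rank_mono) auto

lemma rank_le_card:
  assumes "finite X" shows "rank indep X \<le> card X"
proof -
  obtain B where "B \<subseteq> X" "indep B" "card B = rank indep X" by (rule basis_exists)
  then show ?thesis using card_mono[OF assms, of B] by auto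
qed

lemma rank_indep: "indep X \<Longrightarrow> rank indep X = card X"
  by (simp add: card_le_rank finite_indep le_antisym rank_le_card)

lemma indep_iff_rank:
  assumes "X \<subseteq> E" shows "indep X \<longleftrightarrow> rank indep X = card X"
proof
  assume *: "rank indep X = card X"
  obtain B where B: "B \<subseteq> X" "indep B" "card B = rank indep X" by (rule basis_exists)
  have "finite X" using assms finite_ground finite_subset by blast
  then have "B = X" using card_subset_eq B * by metis
  then show "indep X" using B by simp
qed (rule rank_indep)

text \<open>While \<open>I\<close> is smaller than a largest independent subset \<open>C\<close> of
  \<open>X\<close>, \<open>augment\<close> supplies an element of \<open>C\<close>, which keeps
  \<open>I\<close> inside \<open>X\<close>. The induction is on the missing cardinality.\<close>

lemma basis_extends:
  assumes "indep I" "I \<subseteq> X"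
  obtains B where "I \<subseteq> B" "B \<subseteq> X" "indep B" "card B = rank indep X"
proof -
  have "\<exists>B. I \<subseteq> B \<and> B \<subseteq> X \<and> indep B \<and> card B = rank indep X"
    using assms
  proof (induction "rank indep X - card I" arbitrary: I rule: less_induct)
    case less
    obtain C where C: "C \<subseteq> X" "indep C" "card C = rank indep X" by (rule basis_exists)
    show ?case
    proof (cases "card I < card C")
      case True
      then obtain y where y: "y \<in> C - I" "indep (insert y I)"
        using augment less.prems C by blast
      have "card (insert y I) = Suc (card I)"
        using y finite_indep[OF less.prems(1)] by simp
      then have "\<exists>B. insert y I \<subseteq> B \<and> B \<subseteq> X \<and> indep B \<and> card B = rank indep X"
        using True C y less.prems by (intro less.hyps) auto
      then show ?thesis by auto
    next
      case False
      then show ?thesis using less.prems C card_le_rank[of I X] by auto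
    qed
  qed
  then show thesis using that by blast
qed

text \<open>A basis \<open>J\<close> of the intersection extends to a basis \<open>K\<close> of the
  union. The parts of \<open>K\<close> in \<open>A\<close> and in \<open>B\<close> are independent,
  and their common part contains \<open>J\<close>.\<close>

lemma rank_submodular:
  "rank indep (A \<union> B) + rank indep (A \<inter> B) \<le> rank indep A + rank indep B"
proof -
  obtain J where J: "J \<subseteq> A \<inter> B" "indep J" "card J = rank indep (A \<inter> B)"
    by (rule basis_exists)
  then obtain K where K: "J \<subseteq> K" "K \<subseteq> A \<union> B" "indep K" "card K = rank indep (A \<union> B)"
    using basis_extends[of J "A \<union> B"] by blast
  have fin: "finite K" using K finite_indep by blast
  have "card K + card (K \<inter> A \<inter> B) = card (K \<inter> A) + card (K \<inter> B)"
  proof -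
    have "K \<inter> A \<union> K \<inter> B = K" "(K \<inter> A) \<inter> (K \<inter> B) = K \<inter> A \<inter> B" using K(2) by auto
    then show ?thesis using card_Un_Int[of "K \<inter> A" "K \<inter> B"] fin by simp
  qed
  moreover have "card J \<le> card (K \<inter> A \<inter> B)"
    using J K fin by (intro card_mono) auto
  moreover have "card (K \<inter> A) \<le> rank indep A" "card (K \<inter> B) \<le> rank indep B"
    using K by (auto intro!: card_le_rank intro: indep_subset)
  ultimately show ?thesis using J K by linarith
qed

text \<open>Membership of \<open>x\<close> in the closure of \<open>X\<close>. Elements outside
  \<open>E\<close> behave like loops and are spanned by every set, so lemmas that enlarge an
  independent set ask for \<open>x \<in> E\<close>.\<close>

definition spans :: "'a set \<Rightarrow> 'a \<Rightarrow> bool" where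
  "spans X x \<longleftrightarrow> rank indep (insert x X) = rank indep X"

lemma rank_insert_le: "rank indep (insert x X) \<le> Suc (rank indep X)"
proof -
  have "rank indep {x} \<le> 1" using rank_le_card[of "{x}"] by simp
  then show ?thesis using rank_submodular[of "{x}" X] by simp
qed

lemma rank_insert_not_spans: "\<not> spans X x \<Longrightarrow> rank indep (insert x X) = Suc (rank indep X)"
  using rank_insert_le[of x X] rank_le_insert[of X x] unfolding spans_def by linarith

text \<open>Submodularity for \<open>Y\<close> and \<open>insert x X\<close>: the gain in rank from
  adding \<open>x\<close> cannot grow when the set grows.\<close>

lemma spans_mono: "spans X x \<Longrightarrow> X \<subseteq> Y \<Longrightarrow> spans Y x"
proof -
  assume *: "spans X x" "X \<subseteq> Y"
  have "rank indep (Y \<union> insert x X) + rank indep (Y \<inter> insert x X)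
        \<le> rank indep Y + rank indep (insert x X)"
    by (rule rank_submodular)
  moreover have "rank indep X \<le> rank indep (Y \<inter> insert x X)"
    using * by (intro rank_mono) auto
  moreover have "Y \<union> insert x X = insert x Y" using * by auto
  moreover have "rank indep Y \<le> rank indep (insert x Y)" by (intro rank_mono) auto
  ultimately show ?thesis using * unfolding spans_def by simp
qed

text \<open>The Mac Lane-Steinitz exchange property: adding \<open>x\<close> uses up the one unit of
  rank that \<open>y\<close> can bring.\<close>

lemma spans_exchange: "spans (insert y X) x \<Longrightarrow> \<not> spans X x \<Longrightarrow> spans (insert x X) y"
  using rank_insert_le[of y X] rank_insert_not_spans[of X x]
    rank_le_insert[of "insert x X" y]
  unfolding spans_def by (auto simp: insert_commute)

lemma rank_Un_spanned:
  assumes "finite Y" "\<And>y. y \<in> Y \<Longrightarrow> spans X y"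
  shows "rank indep (X \<union> Y) = rank indep X"
  using assms
proof (induction Y rule: finite_induct)
  case (insert y Y)
  then have "spans (X \<union> Y) y" using spans_mono[of X y "X \<union> Y"] by auto
  then show ?case using insert unfolding spans_def by simp
qed simp

lemma spans_trans:
  assumes "finite Y" "\<And>y. y \<in> Y \<Longrightarrow> spans X y" "spans (X \<union> Y) x"
  shows "spans X x"
proof -
  have "rank indep (insert x X) \<le> rank indep (insert x (X \<union> Y))" by (intro rank_mono) auto
  also have "\<dots> = rank indep X" using assms(3) rank_Un_spanned[OF assms(1,2)] unfolding spans_def by simp
  finally show ?thesis
    using rank_le_insert[of X x] unfolding spans_def by linarith
qed

lemma spans_self: "x \<in> X \<Longrightarrow> spans X x"
  unfolding spans_def by (simp add: insert_absorb)

lemma indep_not_spans: "indep I \<Longrightarrow> y \<in> I \<Longrightarrow> \<not> spans (I - {y}) y"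
  using rank_indep[of I] rank_indep[of "I - {y}"] indep_subset[of I "I - {y}"] finite_indep[of I]
    card_Suc_Diff1[of I y]
  unfolding spans_def by (auto simp: insert_absorb)

lemma indep_insert:
  assumes "indep I" "x \<in> E" "\<not> spans I x"
  shows "indep (insert x I)"
proof -
  have "x \<notin> I" using assms spans_self by blast
  then show ?thesis
    using assms rank_insert_not_spans[of I x] rank_indep[of I] finite_indep[of I]
      indep_subset_ground[of I] indep_iff_rank[of "insert x I"] by simp
qed

text \<open>The hypothesis places every \<open>y\<close> outside the fundamental circuit of
  \<open>x\<close>, and deleting all of \<open>Y\<close> leaves that circuit intact. In terms of
  spans: if deleting a further \<open>y\<close> of \<open>I\<close> broke the span, exchange would
  make \<open>y\<close> spanned by \<open>I - {y}\<close>.\<close>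

lemma spans_Diff:
  assumes "indep I" "finite Y" "spans I x" "\<And>y. y \<in> Y \<Longrightarrow> spans (I - {y}) x"
  shows "spans (I - Y) x"
  using assms(2,4)
proof (induction Y rule: finite_induct)
  case (insert y Y)
  show ?case
  proof (cases "y \<in> I - Y")
    case True
    show ?thesis
    proof (rule ccontr)
      assume n: "\<not> spans (I - insert y Y) x"
      have eq: "insert y (I - insert y Y) = I - Y" using True by auto
      have "spans (insert x (I - insert y Y)) y"
        by (rule spans_exchange[OF _ n]) (use insert eq in auto)
      then have "spans ((I - {y}) \<union> {x}) y" by (rule spans_mono) auto
      then have "spans (I - {y}) y"
        by (rule spans_trans[rotated 2]) (use insert in auto)
      then show False using indep_not_spans assms(1) True by blast
    qed
  next
    case False
    then have "I - insert y Y = I - Y" by auto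
    then show ?thesis using insert by auto
  qed
qed (use assms in auto)

text \<open>The exchanges are made one after another. By \<open>noshort\<close> the elements removed
  before round \<open>j\<close> are outside the fundamental circuit of \<open>x j\<close>, so this
  circuit survives until \<open>x j\<close> replaces \<open>y j\<close>, which lies on it. The
  closure never grows beyond that of \<open>I\<close>, so \<open>z\<close> can be added at the
  end.\<close>

lemma indep_exchange_sequence:
  fixes x y :: "nat \<Rightarrow> 'a" and k :: nat
  assumes I: "indep I"
    and yI: "\<And>j. j < k \<Longrightarrow> y j \<in> I" and xE: "\<And>j. j < k \<Longrightarrow> x j \<in> E - I"
    and sp: "\<And>j. j < k \<Longrightarrow> spans I (x j)"
    and ex: "\<And>j. j < k \<Longrightarrow> \<not> spans (I - {y j}) (x j)"
    and noshort: "\<And>i j. i < j \<Longrightarrow> j < k \<Longrightarrow> spans (I - {y i}) (x j)"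
    and z: "z \<in> E" "\<not> spans I z"
  defines "J \<equiv> insert z (I - y ` {..<k} \<union> x ` {..<k})"
  shows "indep J \<and> card J = Suc (card I)"
proof -
  define K where "K j = I - y ` {..<j} \<union> x ` {..<j}" for j
  have K: "indep (K j) \<and> card (K j) = card I" if "j \<le> k" for j
    using that
  proof (induction j)
    case 0
    then show ?case using I by (simp add: K_def)
  next
    case (Suc j)
    then have IH: "indep (K j)" "card (K j) = card I" and j: "j < k" by auto
    \<comment> \<open>An equal earlier \<open>y i\<close> would be both on and off the fundamental
      circuit of \<open>x j\<close>.\<close>
    have yj: "y j \<notin> y ` {..<j}" using ex noshort j by fastforce
    \<comment> \<open>\<open>A\<close> is the part of \<open>I\<close> that is still present after
      \<open>j\<close> exchanges; it contains the rest of the circuit of \<open>x j\<close>.\<close>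
    define A where "A = I - y ` {..<j}"
    have yA: "y j \<in> A" using yj yI j by (auto simp: A_def)
    have AK: "A \<subseteq> K j" by (auto simp: A_def K_def)
    have spA: "spans A (x j)"
      unfolding A_def
    proof (rule spans_Diff[OF I _ sp[OF j]])
      fix y' assume "y' \<in> y ` {..<j}"
      then show "spans (I - {y'}) (x j)" using noshort[OF _ j] by blast
    qed simp
    have "\<not> spans (A - {y j}) (x j)"
      using ex[OF j] spans_mono[of "A - {y j}" "x j" "I - {y j}"] by (auto simp: A_def)
    then have "spans (insert (x j) (A - {y j})) (y j)"
      by (rule spans_exchange[rotated]) (simp add: spA yA insert_absorb)
    then have sp_y: "spans ((K j - {y j}) \<union> {x j}) (y j)"
      by (rule spans_mono) (use AK in auto)
    \<comment> \<open>Otherwise \<open>sp_y\<close> and transitivity would make \<open>y j\<close>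
      spanned by the other elements of the independent set \<open>K j\<close>.\<close>
    have ns: "\<not> spans (K j - {y j}) (x j)"
    proof
      assume "spans (K j - {y j}) (x j)"
      then have "spans (K j - {y j}) (y j)"
        using spans_trans[of "{x j}" "K j - {y j}" "y j"] sp_y by auto
      then show False using indep_not_spans IH yA AK by blast
    qed
    have "indep (K j - {y j})" using indep_subset IH by blast
    then have ind: "indep (insert (x j) (K j - {y j}))"
      using indep_insert ns xE j by blast
    have xK: "x j \<notin> K j - {y j}" using ns spans_self[of "x j" "K j - {y j}"] by argo
    have "K (Suc j) = insert (x j) (K j - {y j})"
    proof -
      have "x ` {..<j} \<inter> I = {}" using xE j by fastforce
      then have "y j \<notin> x ` {..<j}" using yI[OF j] by blast
      then show ?thesis unfolding K_def lessThan_Suc image_insert by blast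
    qed
    moreover have "card (insert (x j) (K j - {y j})) = card (K j)"
      using xK yA AK finite_indep[OF IH(1)] card_Suc_Diff1[of "K j" "y j"] by auto
    ultimately show ?case using ind IH by simp
  qed
  \<comment> \<open>\<open>K k\<close> lies in the closure of \<open>I\<close>, which does not
    contain \<open>z\<close>.\<close>
  have "\<not> spans (K k) z"
  proof
    assume "spans (K k) z"
    then have "spans (I \<union> x ` {..<k}) z" by (rule spans_mono) (auto simp: K_def)
    then have "spans I z" by (rule spans_trans[rotated 2]) (use sp in auto)
    then show False using z by blast
  qed
  moreover from this have "z \<notin> K k" using spans_self by blast
  ultimately have "indep (insert z (K k)) \<and> card (insert z (K k)) = Suc (card I)"
    using K[of k] indep_insert z finite_indep by auto
  then show ?thesis unfolding J_def K_def .
qed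

end

section \<open>The exchange graph\<close>

text \<open>The oracle is a parameter \<open>f\<close> of its own, so that the same
  \<open>f\<close>, and hence the same program run, can be read with the two matroids in either
  order.\<close>

locale matroid_pair =
  M1: matroid E indep1 + M2: matroid E indep2
  for E :: "'a set" and indep1 indep2 :: "'a set \<Rightarrow> bool" +
  fixes f :: "'a set \<Rightarrow> nat"
  assumes f_eq: "X \<subseteq> E \<Longrightarrow> f X = min_rank indep1 indep2 X"
begin

text \<open>Both ranks are at most \<open>card X\<close>, so their minimum reaches it only if both
  do. One oracle call thus tests common independence.\<close>

lemma common_indep_iff: "common_indep indep1 indep2 X \<longleftrightarrow> X \<subseteq> E \<and> f X = card X"
proof (cases "X \<subseteq> E")
  case True
  then have "finite X" using M1.finite_ground finite_subset by blast
  then have "rank indep1 X \<le> card X" "rank indep2 X \<le> card X"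
    by (simp_all add: M1.rank_le_card M2.rank_le_card)
  then show ?thesis
    using True f_eq[OF True] M1.indep_iff_rank[OF True] M2.indep_iff_rank[OF True]
    unfolding common_indep_def min_rank_def by auto
next
  case False
  then show ?thesis using M1.indep_subset_ground unfolding common_indep_def by blast
qed

lemma common_indep_subset: "common_indep indep1 indep2 X \<Longrightarrow> Y \<subseteq> X \<Longrightarrow> common_indep indep1 indep2 Y"
  using M1.indep_subset M2.indep_subset unfolding common_indep_def by blast

text \<open>The easy half of the matroid intersection min-max theorem: a common independent set has
  at most \<open>rank indep2 U\<close> elements in \<open>U\<close> and at most
  \<open>rank indep1 (E - U)\<close> outside.\<close>

lemma max_common_by_ranks:
  assumes I: "common_indep indep1 indep2 I"
    and U: "U \<subseteq> E" and r: "rank indep2 U + rank indep1 (E - U) \<le> card I"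
  shows "max_common_indep indep1 indep2 I"
  unfolding max_common_indep_def
proof (intro conjI allI impI I)
  fix J assume J: "common_indep indep1 indep2 J"
  then have fin: "finite J" "J \<subseteq> E" and ind: "indep1 J" "indep2 J"
    using M1.finite_indep M1.indep_subset_ground by (auto simp: common_indep_def)
  have "card J = card (J \<inter> U) + card (J - U)"
    using fin by (metis card_Int_Diff)
  also have "card (J \<inter> U) \<le> rank indep2 U"
    using ind M2.indep_subset[of J "J \<inter> U"] by (intro M2.card_le_rank) auto
  also have "card (J - U) \<le> rank indep1 (E - U)"
    using ind fin M1.indep_subset[of J "J - U"] by (intro M1.card_le_rank) auto
  finally show "card J \<le> card I" using r by linarith
qed

end

text \<open>In the exchange graph of \<open>I\<close> the arcs are \<open>x \<rightarrow> y\<close> for \<open>\<not> M2.spans (I - {y}) x\<close> and \<open>y \<rightarrow> x\<close> for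
  \<open>\<not> M1.spans (I - {y}) x\<close>. The first branch of \<open>link\<close> drops all arcs at \<open>y\<close> in the relevant
  direction but the one that joins it to \<open>a\<close>.\<close>

definition link :: "('a set \<Rightarrow> nat) \<Rightarrow> 'a set \<Rightarrow> 'a \<Rightarrow> 'a \<Rightarrow> 'a \<Rightarrow> bool" where
  "link f I a y x \<longleftrightarrow>
     (if f (insert a (I - {y})) = card I then x = a
      else f (insert x (insert a (I - {y}))) = card I)"

text \<open>A subgraph of the exchange graph that the oracle can decide. Arcs into \<open>I\<close>
  concern the second matroid and are tested with \<open>s\<close>, which lifts the first rank out of
  the way; arcs out of \<open>I\<close> concern the first and are tested with
  \<open>t\<close>.\<close>

definition edge :: "('a set \<Rightarrow> nat) \<Rightarrow> 'a set \<Rightarrow> 'a \<Rightarrow> 'a \<Rightarrow> 'a \<Rightarrow> 'a \<Rightarrow> bool" where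
  "edge f I s t u v \<longleftrightarrow>
     (u \<notin> I \<and> v \<in> I \<and> link f I s v u) \<or> (u \<in> I \<and> v \<notin> I \<and> link f I t u v)"

text \<open>For \<open>a = t\<close> these are the sources and for \<open>a = s\<close> the sinks of
  the exchange graph.\<close>

definition partners :: "('a set \<Rightarrow> nat) \<Rightarrow> 'a set \<Rightarrow> 'a \<Rightarrow> 'a set \<Rightarrow> 'a set" where
  "partners f I a E = {x \<in> E - I. f (insert x (insert a I)) = Suc (card I)}"

text \<open>Sources are the elements not spanned by \<open>I\<close> in the first matroid, sinks
  those not spanned in the second. Maximality makes the two kinds disjoint.\<close>

locale exchange_graph = matroid_pair E indep1 indep2 f
  for E :: "'a set" and indep1 indep2 f +
  fixes I :: "'a set" and s t :: 'a
  assumes common: "indep1 I" "indep2 I"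
    and maximal: "\<And>x. x \<in> E - I \<Longrightarrow> M1.spans I x \<or> M2.spans I x"
    and s: "s \<in> E - I" "\<not> M1.spans I s"
    and t: "t \<in> E - I" "\<not> M2.spans I t"
begin

lemma IE: "I \<subseteq> E" and finI: "finite I"
  using common M1.indep_subset_ground M1.finite_indep by blast+

lemma s2: "M2.spans I s" and t1: "M1.spans I t"
  using maximal s t by blast+

text \<open>The sink \<open>t\<close> raises the second rank of \<open>I\<close> to
  \<open>card I + 1\<close> and leaves the first unchanged, so the answer depends on whether
  \<open>x\<close> raises the first rank.\<close>

lemma partners_t: "partners f I t E = {x \<in> E - I. \<not> M1.spans I x}"
proof -
  have "f (insert x (insert t I)) = Suc (card I) \<longleftrightarrow> \<not> M1.spans I x" if x: "x \<in> E - I" for x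
  proof -
    have r1: "rank indep1 (insert x (insert t I)) = rank indep1 (insert x I)"
      using M1.spans_mono[OF t1, of "insert x I"] by (auto simp: M1.spans_def insert_commute)
    have r2: "rank indep2 (insert t I) = Suc (card I)"
      using M2.rank_insert_not_spans t M2.rank_indep common by simp
    have f: "f (insert x (insert t I)) =
        min (rank indep1 (insert x I)) (rank indep2 (insert x (insert t I)))"
      using f_eq[of "insert x (insert t I)"] x t IE r1 by (auto simp: min_rank_def)
    show ?thesis
    proof (cases "M1.spans I x")
      case True
      then have "rank indep1 (insert x I) = card I"
        using M1.rank_indep common by (simp add: M1.spans_def)
      then show ?thesis using True f by auto
    next
      case False
      then have "rank indep1 (insert x I) = Suc (card I)"
        using M1.rank_insert_not_spans M1.rank_indep common by simp
      moreover have "M2.spans (insert t I) x"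
        using maximal[OF x] False M2.spans_mono[of I x "insert t I"] by auto
      ultimately show ?thesis using False f r2 by (simp add: M2.spans_def)
    qed
  qed
  then show ?thesis unfolding partners_def by blast
qed

text \<open>With \<open>t\<close> added, the second rank of \<open>I - {y}\<close> is
  \<open>card I\<close>, so the minimum shows the first rank. If \<open>t\<close> is spanned by
  \<open>I - {y}\<close> in the first matroid, its presence does not disturb the test of
  \<open>x\<close>.\<close>

lemma link_t:
  assumes x: "x \<in> E - I" and y: "y \<in> I"
  shows "link f I t y x \<longleftrightarrow>
    (if M1.spans (I - {y}) t then \<not> M1.spans (I - {y}) x else x = t)"
proof -
  obtain c where c: "card I = Suc c" "card (I - {y}) = c"
    using y finI by (metis card_Suc_Diff1)
  have r0: "rank indep1 (I - {y}) = c" "rank indep2 (I - {y}) = c"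
    using common M1.rank_indep[of "I - {y}"] M1.indep_subset[of I "I - {y}"]
      M2.rank_indep[of "I - {y}"] M2.indep_subset[of I "I - {y}"] c(2) by auto
  have n2: "\<not> M2.spans (I - {y}) t" using M2.spans_mono[of "I - {y}" t I] t by auto
  then have r2: "rank indep2 (insert t (I - {y})) = card I"
    using M2.rank_insert_not_spans r0 c(1) by simp
  have f1: "f (insert t (I - {y})) = card I \<longleftrightarrow> \<not> M1.spans (I - {y}) t"
  proof -
    have "f (insert t (I - {y})) = min (rank indep1 (insert t (I - {y}))) (card I)"
      using f_eq[of "insert t (I - {y})"] t IE r2 by (auto simp: min_rank_def)
    moreover have "rank indep1 (insert t (I - {y})) =
        (if M1.spans (I - {y}) t then c else card I)"
      using r0 c(1) M1.rank_insert_not_spans[of "I - {y}" t] by (simp add: M1.spans_def)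
    ultimately show ?thesis using c(1) by (simp split: if_splits)
  qed
  have f2: "f (insert x (insert t (I - {y}))) = card I \<longleftrightarrow> \<not> M1.spans (I - {y}) x"
    if sp: "M1.spans (I - {y}) t"
  proof -
    have r1: "rank indep1 (insert x (insert t (I - {y}))) = rank indep1 (insert x (I - {y}))"
      using M1.spans_mono[OF sp, of "insert x (I - {y})"]
      unfolding M1.spans_def by (simp add: subset_insertI insert_commute)
    have "f (insert x (insert t (I - {y}))) =
        min (rank indep1 (insert x (I - {y}))) (rank indep2 (insert x (insert t (I - {y}))))"
      using f_eq[of "insert x (insert t (I - {y}))"] t IE x r1 by (auto simp: min_rank_def)
    moreover have "card I \<le> rank indep2 (insert x (insert t (I - {y})))"
      using M2.rank_mono[of "insert t (I - {y})" "insert x (insert t (I - {y}))"] r2 by auto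
    moreover have "rank indep1 (insert x (I - {y})) =
        (if M1.spans (I - {y}) x then c else card I)"
      using r0 c(1) M1.rank_insert_not_spans[of "I - {y}" x] by (simp add: M1.spans_def)
    ultimately show ?thesis using c(1) by (simp add: min_def split: if_splits)
  qed
  show ?thesis
  proof (cases "M1.spans (I - {y}) t")
    case True
    with f1 have "f (insert t (I - {y})) \<noteq> card I" by blast
    then show ?thesis by (simp only: link_def if_False if_True True f2)
  next
    case False
    with f1 have "f (insert t (I - {y})) = card I" by blast
    then show ?thesis by (simp only: link_def simp_thms if_True if_False False)
  qed
qed

lemma link_t_t: "y \<in> I \<Longrightarrow> \<not> M1.spans (I - {y}) t \<Longrightarrow> link f I t y t"
  using link_t[OF t(1), of y] by simp

lemma link_t_imp:
  assumes "x \<in> E - I" "y \<in> I" "link f I t y x"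
  shows "\<not> M1.spans (I - {y}) x"
  using link_t[OF assms(1,2)] assms(3) by (simp split: if_splits)

text \<open>An arc of the full exchange graph that \<open>edge\<close> omits leaves a substitute arc
  from \<open>y\<close> to \<open>t\<close>. This makes the subgraph suffice both for the optimality
  certificate and for excluding shortcuts.\<close>

lemma link_t_cases:
  assumes "x \<in> E - I" "y \<in> I" "\<not> M1.spans (I - {y}) x"
  shows "link f I t y x \<or> link f I t y t"
  using link_t[OF assms(1,2)] link_t_t[OF assms(2)] assms(3) by (simp split: if_splits)

end

lemma exchange_graph_swap:
  assumes "exchange_graph E i1 i2 f I s t"
  shows "exchange_graph E i2 i1 f I t s"
proof -
  interpret exchange_graph E i1 i2 f I s t by fact
  show ?thesis
  proof unfold_locales
    fix X assume "X \<subseteq> E"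
    then show "f X = min_rank i2 i1 X" using f_eq[of X] by (simp add: min_rank_def min.commute)
  next
    fix x assume "x \<in> E - I"
    then show "M2.spans I x \<or> M1.spans I x" using maximal[of x] by argo
  qed (use common s t in simp_all)
qed

section \<open>Optimality certificates and augmentation along paths\<close>

context exchange_graph
begin

text \<open>Swapping the matroids reverses the arcs and exchanges source and sink, which turns each
  fact about \<open>t\<close> into one about \<open>s\<close>.\<close>

interpretation swapped: exchange_graph E indep2 indep1 f I t s
  by (rule exchange_graph_swap, unfold_locales)

lemmas partners_s = swapped.partners_t
lemmas link_s_imp = swapped.link_t_imp
lemmas link_s_cases = swapped.link_t_cases

text \<open>No full arc leaves \<open>U\<close>, so \<open>I \<inter> U\<close> spans
  \<open>U\<close> in the second matroid and \<open>I - U\<close> spans \<open>E - U\<close> in the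
  first. The two ranks then add up to \<open>card I\<close>.\<close>

lemma max_if_closed:
  assumes UE: "U \<subseteq> E" and src: "partners f I t E \<subseteq> U" and snk: "U \<inter> partners f I s E = {}"
    and closed: "\<And>u v. u \<in> U \<Longrightarrow> v \<in> E \<Longrightarrow> edge f I s t u v \<Longrightarrow> v \<in> U"
  shows "max_common_indep indep1 indep2 I"
proof (rule max_common_by_ranks)
  show "common_indep indep1 indep2 I" using common by (simp add: common_indep_def)
  show "U \<subseteq> E" by (fact UE)
  have fin: "finite U" "finite (E - U)" using UE M1.finite_ground finite_subset by auto
  have sU: "s \<in> U" using s src partners_t by auto
  have tU: "t \<notin> U" using t snk partners_s by auto
  have "M2.spans (I \<inter> U) x" if x: "x \<in> U" for x
  proof (cases "x \<in> I")
    case True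
    then show ?thesis using x M2.spans_self by auto
  next
    case False
    then have xE: "x \<in> E - I" using x UE by auto
    have "M2.spans (I - {y}) x" if y: "y \<in> I - U" for y
    proof (rule ccontr)
      assume "\<not> M2.spans (I - {y}) x"
      \<comment> \<open>The substitute arc starts at \<open>s\<close>, which is in \<open>U\<close>
        as a source, so it too would bring \<open>y\<close> into \<open>U\<close>.\<close>
      then have "link f I s y x \<or> link f I s y s" using link_s_cases xE y by auto
      then have "edge f I s t x y \<or> edge f I s t s y" using xE s y by (auto simp: edge_def)
      then show False using closed x sU y IE by blast
    qed
    moreover have "M2.spans I x" using snk x xE partners_s by auto
    ultimately have "M2.spans (I - (I - U)) x"
      using M2.spans_Diff[OF common(2), of "I - U" x] finI by blast
    then show ?thesis by (simp add: Diff_Diff_Int)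
  qed
  then have "rank indep2 (I \<inter> U \<union> U) = rank indep2 (I \<inter> U)"
    using fin M2.rank_Un_spanned by blast
  then have r2: "rank indep2 U = card (I \<inter> U)"
    using M2.rank_indep[of "I \<inter> U"] M2.indep_subset[of I "I \<inter> U"] common
    by (simp add: Int_commute Un_absorb1)
  have "M1.spans (I - U) x" if x: "x \<in> E - U" for x
  proof (cases "x \<in> I")
    case True
    then show ?thesis using x M1.spans_self by auto
  next
    case False
    then have xE: "x \<in> E - I" using x by auto
    have "M1.spans (I - {y}) x" if y: "y \<in> I \<inter> U" for y
    proof (rule ccontr)
      assume "\<not> M1.spans (I - {y}) x"
      \<comment> \<open>The substitute arc ends at \<open>t\<close>, a sink, which cannot be in
        \<open>U\<close>.\<close>
      then have "link f I t y x \<or> link f I t y t" using link_t_cases xE y by auto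
      then have "edge f I s t y x \<or> edge f I s t y t" using xE t y by (auto simp: edge_def)
      then show False using closed x tU t y by blast
    qed
    moreover have "M1.spans I x" using src x xE partners_t by auto
    ultimately have "M1.spans (I - (I \<inter> U)) x"
      using M1.spans_Diff[OF common(1), of "I \<inter> U" x] finI by blast
    then show ?thesis by (simp add: Diff_Int)
  qed
  then have "rank indep1 ((I - U) \<union> (E - U)) = rank indep1 (I - U)"
    using fin M1.rank_Un_spanned by blast
  moreover have "(I - U) \<union> (E - U) = E - U" using IE by auto
  ultimately have "rank indep1 (E - U) = card (I - U)"
    using M1.rank_indep[of "I - U"] M1.indep_subset[of I "I - U"] common by simp
  then show "rank indep2 U + rank indep1 (E - U) \<le> card I"
    using r2 card_Int_Diff[OF finI, of U] by linarith
qed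

text \<open>\<open>noshort\<close> speaks of the subgraph only; \<open>no_s\<close> and
  \<open>no_t\<close> exclude the substitute arcs, so the path has no shortcut in the full exchange
  graph either. The exchange sequence lemma then applies once in each matroid.\<close>

lemma augment_along:
  fixes v :: "nat \<Rightarrow> 'a" and m :: nat
  assumes vE: "\<And>l. l \<le> m \<Longrightarrow> v l \<in> E"
    and arcs: "\<And>l. l < m \<Longrightarrow> edge f I s t (v l) (v (Suc l))"
    and noshort: "\<And>i j. Suc i < j \<Longrightarrow> j \<le> m \<Longrightarrow> \<not> edge f I s t (v i) (v j)"
    and no_s: "\<And>j. 1 < j \<Longrightarrow> j \<le> m \<Longrightarrow> \<not> edge f I s t s (v j)"
    and no_t: "\<And>i. Suc i < m \<Longrightarrow> \<not> edge f I s t (v i) t"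
    and src: "\<And>l. l \<le> m \<Longrightarrow> v l \<in> partners f I t E \<longleftrightarrow> l = 0"
    and snk: "\<And>l. l \<le> m \<Longrightarrow> v l \<in> partners f I s E \<longleftrightarrow> l = m"
  defines "J \<equiv> (I - v ` {..m}) \<union> (v ` {..m} - I)"
  shows "common_indep indep1 indep2 J" "card J = Suc (card I)"
proof -
  have alt: "v l \<in> I \<longleftrightarrow> odd l" if "l \<le> m" for l
    using that
  proof (induction l)
    case 0
    then show ?case using src[of 0] by (auto simp: partners_def)
  next
    case (Suc l)
    then show ?case using arcs[of l] by (auto simp: edge_def)
  qed
  have "even m" using alt[of m] snk[of m] by (auto simp: partners_def)
  then obtain k where m: "m = 2 * k" by (elim evenE)
  have "v 0 \<in> partners f I t E" "v m \<in> partners f I s E" using src snk by auto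
  then have v0: "v 0 \<in> E" "\<not> M1.spans I (v 0)" and vm: "v m \<in> E" "\<not> M2.spans I (v m)"
    using partners_t partners_s by auto
  have xE: "v (2 * i) \<in> E - I" if "i \<le> k" for i using alt vE m that by auto
  have yI: "v (Suc (2 * i)) \<in> I" if "i < k" for i using alt[of "Suc (2 * i)"] m that by auto
  \<comment> \<open>The first matroid pairs each vertex of \<open>I\<close> with its successor and
    is left with \<open>v 0\<close> as the extra element.\<close>
  define y1 x1 where "y1 i = v (Suc (2 * i))" and "x1 i = v (2 * Suc i)" for i
  \<comment> \<open>The second matroid pairs each vertex of \<open>I\<close> with its predecessor
    and is left with \<open>v m\<close>. The order is reversed, because here a shortcut leads from
    an earlier \<open>x\<close> to a later \<open>y\<close>.\<close>
  define y2 x2 where "y2 i = v (Suc (2 * (k - Suc i)))" and "x2 i = v (2 * (k - Suc i))" for i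
  have evens: "{l. l \<le> 2 * k \<and> even l} = (\<lambda>i. 2 * i) ` {..k}"
    by (auto elim!: evenE)
  have odds: "{l. l \<le> 2 * k \<and> odd l} = (\<lambda>i. Suc (2 * i)) ` {..<k}"
    by (auto elim!: oddE)
  have vin: "v ` {..m} - I = v ` (\<lambda>i. 2 * i) ` {..k}" and vout: "v ` {..m} \<inter> I = y1 ` {..<k}"
    unfolding y1_def image_image[symmetric, of v "\<lambda>i. Suc (2 * i)"]
      evens[symmetric] odds[symmetric] using alt m by auto
  have IV: "I - v ` {..m} = I - y1 ` {..<k}" using vout by blast
  have set1: "J = insert (v 0) (I - y1 ` {..<k} \<union> x1 ` {..<k})"
  proof -
    have "{..k} = insert 0 (Suc ` {..<k})" by (simp add: lessThan_Suc_atMost[symmetric] lessThan_Suc_eq_insert_0)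
    then have "v ` (\<lambda>i. 2 * i) ` {..k} = insert (v 0) (x1 ` {..<k})"
      unfolding x1_def by (auto simp: image_iff)
    then show ?thesis unfolding J_def IV vin by auto
  qed
  have rev: "(\<lambda>i. k - Suc i) ` {..<k} = {..<k}"
  proof (intro equalityI subsetI)
    fix i assume "i \<in> {..<k}"
    then have "i = k - Suc (k - Suc i)" "k - Suc i < k" by auto
    then show "i \<in> (\<lambda>i. k - Suc i) ` {..<k}" by blast
  qed auto
  have y2_eq: "y2 ` {..<k} = y1 ` {..<k}"
  proof -
    have "y2 = y1 \<circ> (\<lambda>i. k - Suc i)" by (simp add: fun_eq_iff y1_def y2_def)
    then show ?thesis using rev by (metis image_comp)
  qed
  have x2_eq: "x2 ` {..<k} = (\<lambda>i. v (2 * i)) ` {..<k}"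
  proof -
    have "x2 = (\<lambda>i. v (2 * i)) \<circ> (\<lambda>i. k - Suc i)" by (simp add: fun_eq_iff x2_def)
    then show ?thesis using rev by (metis image_comp)
  qed
  have set2: "J = insert (v m) (I - y2 ` {..<k} \<union> x2 ` {..<k})"
  proof -
    have "v ` (\<lambda>i. 2 * i) ` {..k} = insert (v m) (x2 ` {..<k})"
      unfolding x2_eq m lessThan_Suc_atMost[symmetric] lessThan_Suc by (simp add: image_image)
    then show ?thesis unfolding J_def y2_eq IV vin by auto
  qed
  have e1: "edge f I s t (v (Suc (2 * i))) (v (2 * Suc j)) \<longleftrightarrow> link f I t (y1 i) (x1 j)"
    if "i < k" "j < k" for i j
    using yI[OF that(1)] xE[of "Suc j"] that by (auto simp: edge_def y1_def x1_def)
  have e2: "edge f I s t (v (2 * i)) (v (Suc (2 * j))) \<longleftrightarrow> link f I s (v (Suc (2 * j))) (v (2 * i))"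
    if "i < k" "j < k" for i j
    using yI[OF that(2)] xE[of i] that by (auto simp: edge_def)
  have M1: "indep1 J \<and> card J = Suc (card I)"
    unfolding set1
  proof (rule M1.indep_exchange_sequence[OF common(1) _ _ _ _ _ v0])
    fix j assume j: "j < k"
    show "y1 j \<in> I" "x1 j \<in> E - I" using yI[OF j] xE[of "Suc j"] j by (auto simp: y1_def x1_def)
    show "M1.spans I (x1 j)"
      using src[of "2 * Suc j"] xE[of "Suc j"] j m partners_t by (auto simp: x1_def)
    show "\<not> M1.spans (I - {y1 j}) (x1 j)"
      using arcs[of "Suc (2 * j)"] e1[OF j j] j m yI[OF j] xE[of "Suc j"]
      by (intro link_t_imp) (auto simp: x1_def y1_def)
  next
    fix i j assume ij: "i < j" "j < k"
    have y: "y1 i \<in> I" and x: "x1 j \<in> E - I"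
      using yI[of i] xE[of "Suc j"] ij by (auto simp: y1_def x1_def)
    have "\<not> link f I t (y1 i) (x1 j)"
      using noshort[of "Suc (2 * i)" "2 * Suc j"] e1[of i j] ij m by auto
    moreover have "\<not> link f I t (y1 i) t"
      using no_t[of "Suc (2 * i)"] ij m t y by (auto simp: edge_def y1_def)
    ultimately show "M1.spans (I - {y1 i}) (x1 j)" using link_t_cases[OF x y] by blast
  qed
  have M2: "indep2 J \<and> card J = Suc (card I)"
    unfolding set2
  proof (rule M2.indep_exchange_sequence[OF common(2) _ _ _ _ _ vm])
    fix j assume j: "j < k"
    define l where "l = k - Suc j"
    have l: "l < k" "y2 j = v (Suc (2 * l))" "x2 j = v (2 * l)"
      using j by (auto simp: l_def y2_def x2_def)
    show "y2 j \<in> I" "x2 j \<in> E - I" using yI[of l] xE[of l] l by auto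
    show "M2.spans I (x2 j)"
      using snk[of "2 * l"] xE[of l] l m partners_s by auto
    show "\<not> M2.spans (I - {y2 j}) (x2 j)"
      using arcs[of "2 * l"] e2[of l l] l m yI[of l] xE[of l]
      by (intro link_s_imp) auto
  next
    fix i j assume ij: "i < j" "j < k"
    define l p where "l = k - Suc j" and "p = k - Suc i"
    have l: "l < p" "p < k" "y2 i = v (Suc (2 * p))" "x2 j = v (2 * l)"
      using ij by (auto simp: l_def p_def y2_def x2_def)
    have y: "y2 i \<in> I" and x: "x2 j \<in> E - I"
      using yI[of p] xE[of l] l by auto
    have "\<not> link f I s (y2 i) (x2 j)"
      using noshort[of "2 * l" "Suc (2 * p)"] e2[of l p] l m by auto
    moreover have "\<not> link f I s (y2 i) s"
      using no_s[of "Suc (2 * p)"] l m s y by (auto simp: edge_def)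
    ultimately show "M2.spans (I - {y2 i}) (x2 j)" using link_s_cases[OF x y] by blast
  qed
  show "common_indep indep1 indep2 J" "card J = Suc (card I)"
    using M1 M2 by (auto simp: common_indep_def)
qed

end

section \<open>Choice of a source and a sink by the oracle\<close>

context matroid_pair
begin

lemma maximal_spans:
  assumes I: "common_indep indep1 indep2 I"
    and max: "\<And>x. x \<in> E - I \<Longrightarrow> \<not> common_indep indep1 indep2 (insert x I)"
    and x: "x \<in> E - I"
  shows "M1.spans I x \<or> M2.spans I x"
  using I max[OF x] x M1.indep_insert[of I x] M2.indep_insert[of I x]
  unfolding common_indep_def by auto

text \<open>A source and a sink together would form a pair. Hence \<open>I\<close> spans
  \<open>E\<close> in one matroid, and \<open>{}\<close> or \<open>E\<close> serves as the
  certificate \<open>U\<close>.\<close>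

lemma max_if_no_pair:
  assumes I: "common_indep indep1 indep2 I"
    and max: "\<And>x. x \<in> E - I \<Longrightarrow> \<not> common_indep indep1 indep2 (insert x I)"
    and nopair: "\<And>a b. a \<in> E - I \<Longrightarrow> b \<in> E - I \<Longrightarrow> f (insert a (insert b I)) \<noteq> Suc (card I)"
  shows "max_common_indep indep1 indep2 I"
proof -
  have ind: "indep1 I" "indep2 I" using I by (auto simp: common_indep_def)
  have IE: "I \<subseteq> E" using ind M1.indep_subset_ground by blast
  have "(\<forall>x\<in>E. M1.spans I x) \<or> (\<forall>x\<in>E. M2.spans I x)"
  proof (rule ccontr)
    assume "\<not> ?thesis"
    then obtain s t where st: "s \<in> E" "\<not> M1.spans I s" "t \<in> E" "\<not> M2.spans I t" by blast
    then have stI: "s \<in> E - I" "t \<in> E - I"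
      using M1.spans_self[of s I] M2.spans_self[of t I] by auto
    interpret exchange_graph E indep1 indep2 f I s t
      by unfold_locales (use ind maximal_spans[OF I max] st stI in auto)
    have "s \<in> partners f I t E" using partners_t st stI by auto
    then show False using nopair[of s t] stI by (auto simp: partners_def)
  qed
  then show ?thesis
  proof
    assume "\<forall>x\<in>E. M1.spans I x"
    then have "rank indep1 (I \<union> E) = rank indep1 I"
      using M1.rank_Un_spanned M1.finite_ground by blast
    then show ?thesis
      using IE ind M1.rank_indep M2.rank_le_card[of "{}"]
      by (intro max_common_by_ranks[OF I, of "{}"]) (auto simp: Un_absorb1)
  next
    assume "\<forall>x\<in>E. M2.spans I x"
    then have "rank indep2 (I \<union> E) = rank indep2 I"
      using M2.rank_Un_spanned M2.finite_ground by blast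
    then show ?thesis
      using IE ind M2.rank_indep M1.rank_le_card[of "{}"]
      by (intro max_common_by_ranks[OF I, of E]) (auto simp: Un_absorb1)
  qed
qed

text \<open>The answer shows that neither matroid spans both \<open>a\<close> and \<open>b\<close>,
  while maximality gives each of them a matroid that spans it. So one is a source and the other a
  sink, but the oracle cannot tell which.\<close>

lemma pair_exchange_graph:
  assumes I: "common_indep indep1 indep2 I"
    and max: "\<And>x. x \<in> E - I \<Longrightarrow> \<not> common_indep indep1 indep2 (insert x I)"
    and ab: "a \<in> E - I" "b \<in> E - I" "f (insert a (insert b I)) = Suc (card I)"
  shows "exchange_graph E indep1 indep2 f I a b \<or> exchange_graph E indep2 indep1 f I a b"
proof -
  have ind: "indep1 I" "indep2 I" using I by (auto simp: common_indep_def)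
  have IE: "I \<subseteq> E" using ind M1.indep_subset_ground by blast
  have f: "f (insert a (insert b I)) =
      min (rank indep1 (I \<union> {a, b})) (rank indep2 (I \<union> {a, b}))"
    using f_eq[of "insert a (insert b I)"] ab IE by (simp add: min_rank_def)
  have sp: "M1.spans I x \<or> M2.spans I x" if "x \<in> E - I" for x
    using maximal_spans[OF I max that] .
  have "\<not> (M1.spans I a \<and> M1.spans I b)"
  proof
    assume "M1.spans I a \<and> M1.spans I b"
    then have "rank indep1 (I \<union> {a, b}) = rank indep1 I"
      by (intro M1.rank_Un_spanned) auto
    then show False using f ab(3) M1.rank_indep[OF ind(1)] by linarith
  qed
  moreover have "\<not> (M2.spans I a \<and> M2.spans I b)"
  proof
    assume "M2.spans I a \<and> M2.spans I b"
    then have "rank indep2 (I \<union> {a, b}) = rank indep2 I"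
      by (intro M2.rank_Un_spanned) auto
    then show False using f ab(3) M2.rank_indep[OF ind(2)] by linarith
  qed
  ultimately have
    "\<not> M1.spans I a \<and> \<not> M2.spans I b \<or> \<not> M2.spans I a \<and> \<not> M1.spans I b"
    using sp[OF ab(1)] sp[OF ab(2)] by blast
  then show ?thesis
  proof
    assume "\<not> M1.spans I a \<and> \<not> M2.spans I b"
    then have "exchange_graph E indep1 indep2 f I a b"
      by unfold_locales (use ind sp ab in simp_all)
    then show ?thesis ..
  next
    assume "\<not> M2.spans I a \<and> \<not> M1.spans I b"
    then have "exchange_graph E indep1 indep2 f I b a"
      by unfold_locales (use ind sp ab in simp_all)
    then show ?thesis by (rule disjI2[OF exchange_graph_swap])
  qed
qed

end

section \<open>Breadth-first search\<close>

text \<open>The queue is \<open>q 0, \<dots>, q (qn - 1)\<close> with the sources in the first \<open>ns\<close> places, and \<open>pp i\<close>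
  is the place of the vertex from which \<open>q i\<close> was reached. The heads before \<open>h\<close> are finished,
  and the head \<open>h\<close> has been compared with the vertices below \<open>w\<close>. That \<open>pp i\<close> is the first
  predecessor of \<open>q i\<close> in the queue makes the search paths free of shortcuts.\<close>

definition bfs_inv ::
  "(nat \<Rightarrow> nat \<Rightarrow> bool) \<Rightarrow> nat set \<Rightarrow> nat \<Rightarrow> (nat \<Rightarrow> nat) \<Rightarrow> (nat \<Rightarrow> nat) \<Rightarrow> nat \<Rightarrow> nat
    \<Rightarrow> nat \<Rightarrow> nat \<Rightarrow> bool" where
  "bfs_inv A S n q pp ns qn h w \<longleftrightarrow>
     inj_on q {..<qn} \<and> q ` {..<qn} \<subseteq> {..<n} \<and> ns \<le> qn \<and> q ` {..<ns} = S \<and>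
     (\<forall>i. ns \<le> i \<and> i < qn \<longrightarrow>
        pp i < i \<and> pp i \<le> h \<and> A (q (pp i)) (q i) \<and> (\<forall>j<pp i. \<not> A (q j) (q i))) \<and>
     (\<forall>i j. ns \<le> i \<and> i \<le> j \<and> j < qn \<longrightarrow> pp i \<le> pp j) \<and>
     (\<forall>j v. j < qn \<and> v < n \<and> (j < h \<or> j = h \<and> v < w) \<and> A (q j) v \<longrightarrow> v \<in> q ` {..<qn})"

lemma bfs_inv_start:
  assumes "inj_on q {..<ns}" "q ` {..<ns} = S" "S \<subseteq> {..<n}"
  shows "bfs_inv A S n q pp ns ns 0 0"
  using assms unfolding bfs_inv_def by auto

lemma bfs_inv_len_le: "bfs_inv A S n q pp ns qn h w \<Longrightarrow> qn \<le> n"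
  unfolding bfs_inv_def using card_inj_on_le[of q "{..<qn}" "{..<n}"] by simp

lemma bfs_inv_skip:
  assumes "bfs_inv A S n q pp ns qn h w" "h < qn \<Longrightarrow> A (q h) w \<Longrightarrow> w \<in> q ` {..<qn}"
  shows "bfs_inv A S n q pp ns qn h (Suc w)"
  using assms unfolding bfs_inv_def less_Suc_eq by blast

lemma bfs_inv_next_head:
  assumes "bfs_inv A S n q pp ns qn h n"
  shows "bfs_inv A S n q pp ns qn (Suc h) 0"
  using assms unfolding bfs_inv_def less_Suc_eq by (auto simp: le_Suc_eq)

text \<open>No earlier head has an arc to \<open>w\<close>, since \<open>w\<close> would then be in
  the queue already; so \<open>h\<close> is the first predecessor. As \<open>h\<close> bounds all
  earlier parents, parents stay monotone along the queue.\<close>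

lemma bfs_inv_add:
  assumes inv: "bfs_inv A S n q pp ns qn h w"
    and w: "w < n" "w \<notin> q ` {..<qn}" and h: "h < qn" "A (q h) w"
  shows "bfs_inv A S n (q(qn := w)) (pp(qn := h)) ns (Suc qn) h (Suc w)"
proof -
  let ?q = "q(qn := w)" and ?pp = "pp(qn := h)"
  have inj: "inj_on q {..<qn}" and sub: "q ` {..<qn} \<subseteq> {..<n}" and ns: "ns \<le> qn" "q ` {..<ns} = S"
    and par: "\<And>i. ns \<le> i \<Longrightarrow> i < qn \<Longrightarrow>
        pp i < i \<and> pp i \<le> h \<and> A (q (pp i)) (q i) \<and> (\<forall>j<pp i. \<not> A (q j) (q i))"
    and mono: "\<And>i j. ns \<le> i \<Longrightarrow> i \<le> j \<Longrightarrow> j < qn \<Longrightarrow> pp i \<le> pp j"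
    and closed: "\<And>j v. j < qn \<Longrightarrow> v < n \<Longrightarrow> j < h \<or> j = h \<and> v < w \<Longrightarrow> A (q j) v \<Longrightarrow>
        v \<in> q ` {..<qn}"
    using inv unfolding bfs_inv_def by blast+
  have img: "?q ` {..<Suc qn} = insert w (q ` {..<qn})"
    by (auto simp: lessThan_Suc image_iff)
  have "inj_on ?q {..<Suc qn}"
    using inj w by (auto simp: inj_on_def less_Suc_eq image_iff)
  moreover have "?q ` {..<Suc qn} \<subseteq> {..<n}" using img sub w by auto
  moreover have "?q ` {..<ns} = S" using ns by (auto simp: image_iff)
  moreover have "?pp i < i \<and> ?pp i \<le> h \<and> A (?q (?pp i)) (?q i) \<and> (\<forall>j<?pp i. \<not> A (?q j) (?q i))"
    if i: "ns \<le> i" "i < Suc qn" for i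
  proof (cases "i = qn")
    case True
    have "\<not> A (q j) w" if "j < h" for j
      using closed[of j w] that h w by auto
    then show ?thesis using True h by auto
  next
    case False
    then have "i < qn" using i by simp
    then show ?thesis using par[OF i(1)] by auto
  qed
  moreover have "?pp i \<le> ?pp j" if "ns \<le> i" "i \<le> j" "j < Suc qn" for i j
  proof (cases "j = qn")
    case True
    then show ?thesis using par[of i] that by (cases "i = qn") auto
  next
    case False
    then show ?thesis using mono[of i j] that by auto
  qed
  moreover have "v \<in> ?q ` {..<Suc qn}"
    if j: "j < Suc qn" "v < n" "j < h \<or> j = h \<and> v < Suc w" "A (?q j) v" for j v
  proof (cases "v = w")
    case False
    have "j < qn" using j h by auto
    then have "v \<in> q ` {..<qn}" using closed[of j v] j False by auto
    then show ?thesis using img by blast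
  qed (use img in blast)
  ultimately show ?thesis
    unfolding bfs_inv_def using ns(1) by (intro conjI allI impI; (elim conjE)?; simp)
qed

text \<open>The values of \<open>p\<close> are places in the queue, not vertices; the path runs from
  a source place to \<open>c\<close> along the parent pointers.\<close>

definition search_path :: "(nat \<Rightarrow> nat) \<Rightarrow> nat \<Rightarrow> nat \<Rightarrow> (nat \<Rightarrow> nat) \<Rightarrow> nat \<Rightarrow> bool" where
  "search_path pp ns c p m \<longleftrightarrow>
     p m = c \<and> p 0 < ns \<and> (\<forall>l<m. p l = pp (p (Suc l)) \<and> ns \<le> p (Suc l) \<and> p l < p (Suc l))"

lemma search_path_exists:
  assumes "bfs_inv A S n q pp ns qn h w" "c < qn"
  shows "\<exists>p m. search_path pp ns c p m"
  using assms(2)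
proof (induction c rule: less_induct)
  case (less c)
  show ?case
  proof (cases "c < ns")
    case True
    then have "search_path pp ns c (\<lambda>_. c) 0" by (simp add: search_path_def)
    then show ?thesis by blast
  next
    case False
    then have pp: "pp c < c" using assms(1) less.prems unfolding bfs_inv_def by auto
    then have "pp c < qn" using less.prems by simp
    then obtain p m where p: "search_path pp ns (pp c) p m" using less.IH[OF pp] by blast
    have "search_path pp ns c (p(Suc m := c)) (Suc m)"
      using p pp False unfolding search_path_def by (auto simp: less_Suc_eq)
    then show ?thesis by blast
  qed
qed

lemma search_path_less:
  assumes "search_path pp ns c p m" "i < j" "j \<le> m" shows "p i < p j"
  using assms(2,3)
proof (induction j)
  case (Suc j)
  have "p j < p (Suc j)" using assms(1) Suc.prems unfolding search_path_def Suc_le_eq by blast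
  then show ?case using Suc by (cases "i = j") auto
qed simp

text \<open>Places increase strictly along the path. The bound shows that \<open>n\<close> rounds
  are enough to walk back from \<open>c\<close>.\<close>

lemma search_path_length: "search_path pp ns c p m \<Longrightarrow> m \<le> c"
proof -
  assume p: "search_path pp ns c p m"
  have "l \<le> p l" if "l \<le> m" for l
    using that
  proof (induction l)
    case (Suc l)
    have "p l < p (Suc l)" using p Suc.prems unfolding search_path_def Suc_le_eq by blast
    then show ?case using Suc by simp
  qed simp
  then show ?thesis using p by (auto simp: search_path_def)
qed

section \<open>Paths without shortcuts from a finished search\<close>

locale finished_search = exchange_graph "{..<n}" indep1 indep2 f I s t
  for n :: nat and indep1 indep2 f I s t +
  fixes q pp :: "nat \<Rightarrow> nat" and ns qn h :: nat
  assumes inv: "bfs_inv (edge f I s t) (partners f I t {..<n}) n q pp ns qn h 0" and h: "qn \<le> h"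
begin

lemma closed: "j < qn \<Longrightarrow> v < n \<Longrightarrow> edge f I s t (q j) v \<Longrightarrow> v \<in> q ` {..<qn}"
  using inv less_le_trans[of j qn h] h unfolding bfs_inv_def by blast

lemma sources: "q ` {..<ns} = partners f I t {..<n}" and ns_le: "ns \<le> qn"
  and inj: "inj_on q {..<qn}" and q_less: "q ` {..<qn} \<subseteq> {..<n}"
  using inv unfolding bfs_inv_def by simp_all

lemma first_pred: "ns \<le> i \<Longrightarrow> i < qn \<Longrightarrow> j < pp i \<Longrightarrow> \<not> edge f I s t (q j) (q i)"
  and pred: "ns \<le> i \<Longrightarrow> i < qn \<Longrightarrow> edge f I s t (q (pp i)) (q i)"
  and pp_mono: "ns \<le> i \<Longrightarrow> i \<le> j \<Longrightarrow> j < qn \<Longrightarrow> pp i \<le> pp j"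
  using inv unfolding bfs_inv_def by simp_all

lemma source_iff: "i < qn \<Longrightarrow> q i \<in> partners f I t {..<n} \<longleftrightarrow> i < ns"
  using inj_on_image_mem_iff[OF inj, of i "{..<ns}"] ns_le sources by auto

lemma max_if_no_sink:
  assumes "\<And>i. i < qn \<Longrightarrow> q i \<notin> partners f I s {..<n}"
  shows "max_common_indep indep1 indep2 I"
proof (rule max_if_closed)
  show "q ` {..<qn} \<subseteq> {..<n}" by (rule q_less)
  show "partners f I t {..<n} \<subseteq> q ` {..<qn}"
    unfolding sources[symmetric] using ns_le by (intro image_mono) simp
  show "q ` {..<qn} \<inter> partners f I s {..<n} = {}" using assms by auto
  fix u v assume "u \<in> q ` {..<qn}" "v \<in> {..<n}" "edge f I s t u v"
  then show "v \<in> q ` {..<qn}" using closed by auto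
qed

text \<open>The path leads to the first sink in the queue. First predecessors rule out shortcuts and
  arcs from \<open>s\<close> to later vertices; the choice of the first sink rules out early arcs to
  \<open>t\<close>.\<close>

lemma augment_search_path:
  assumes c: "c < qn" "q c \<in> partners f I s {..<n}"
    and first: "\<And>i. i < c \<Longrightarrow> q i \<notin> partners f I s {..<n}"
    and p: "search_path pp ns c p m"
  defines "P \<equiv> q ` p ` {..m}"
  shows "common_indep indep1 indep2 ((I - P) \<union> (P - I))"
    and "card ((I - P) \<union> (P - I)) = Suc (card I)"
proof -
  have pm: "p m = c" and p0: "p 0 < ns"
    and step: "l < m \<Longrightarrow> p l = pp (p (Suc l))" "l < m \<Longrightarrow> ns \<le> p (Suc l)" for l
    using p unfolding search_path_def by auto
  have less: "p i < p j" if "i < j" "j \<le> m" for i j by (rule search_path_less[OF p that])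
  have ple: "p l \<le> c" if "l \<le> m" for l using less[of l m] pm that by (cases "l = m") auto
  then have pqn: "p l < qn" if "l \<le> m" for l using that c by fastforce
  have pns: "ns \<le> p l" if "0 < l" "l \<le> m" for l using step(2)[of "l - 1"] that by simp
  have pred_p: "pp (p l) = p (l - 1)" if "0 < l" "l \<le> m" for l using step(1)[of "l - 1"] that by simp
  note facts = augment_along[of m "\<lambda>l. q (p l)"]
  have prem1: "q (p l) \<in> {..<n}" if "l \<le> m" for l using q_less pqn[OF that] by auto
  have prem2: "edge f I s t (q (p l)) (q (p (Suc l)))" if "l < m" for l
    using pred[of "p (Suc l)"] step[OF that] pqn[of "Suc l"] that by simp
  \<comment> \<open>The parent of \<open>p j\<close> is \<open>p (j - 1)\<close>, and the earlier
    place \<open>p i\<close> cannot be a predecessor.\<close>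
  have prem3: "\<not> edge f I s t (q (p i)) (q (p j))" if "Suc i < j" "j \<le> m" for i j
    using first_pred[of "p j" "p i"] pns[of j] pqn[of j] pred_p[of j] less[of i "j - 1"] that by simp
  \<comment> \<open>\<open>s\<close> is among the sources in the first \<open>ns\<close> places,
    while the parent of \<open>p j\<close> is beyond them because \<open>j > 1\<close>.\<close>
  have prem4: "\<not> edge f I s t s (q (p j))" if "1 < j" "j \<le> m" for j
  proof -
    have "s \<in> q ` {..<ns}" unfolding sources partners_t using s by simp
    then obtain i where i: "i < ns" "s = q i" by auto
    have "j - 1 \<le> m" "0 < j - 1" using that by linarith+
    then have "i < pp (p j)" using pred_p[of j] pns[of "j - 1"] i that by linarith
    then show ?thesis using first_pred[of "p j" i] pns[of j] pqn[of j] that i by simp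
  qed
  \<comment> \<open>Such an arc would give \<open>t\<close> a parent before that of
    \<open>c\<close>. By monotonicity of \<open>pp\<close> the sink \<open>t\<close> would then
    precede \<open>c\<close>, the first sink.\<close>
  have prem5: "\<not> edge f I s t (q (p i)) t" if "Suc i < m" for i
  proof
    assume e: "edge f I s t (q (p i)) t"
    have "t \<in> q ` {..<qn}" by (rule closed[OF pqn _ e]) (use that t in auto)
    then obtain k where k: "k < qn" "t = q k" by auto
    have "t \<notin> partners f I t {..<n}" unfolding partners_t using t1 by simp
    then have kns: "ns \<le> k" using source_iff[OF k(1)] k by simp
    have "pp k \<le> p i" using first_pred[OF kns k(1), of "p i"] e k by force
    also have "p i < p (m - 1)" using less[of i "m - 1"] that by simp
    also have "p (m - 1) = pp c" using pred_p[of m] that pm by simp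
    finally have "k < c" using pp_mono[of c k] pns[of m] pm that k by force
    moreover have "t \<in> partners f I s {..<n}" unfolding partners_s using t by simp
    ultimately show False using first k by simp
  qed
  have prem6: "q (p l) \<in> partners f I t {..<n} \<longleftrightarrow> l = 0" if "l \<le> m" for l
    using source_iff[OF pqn[OF that]] pns[of l] p0 that by (cases "l = 0") auto
  have prem7: "q (p l) \<in> partners f I s {..<n} \<longleftrightarrow> l = m" if "l \<le> m" for l
    using first[of "p l"] less[of l m] pm c that by (cases "l = m") auto
  have P: "P = (\<lambda>l. q (p l)) ` {..m}" unfolding P_def by (simp add: image_image)
  show "common_indep indep1 indep2 ((I - P) \<union> (P - I))" "card ((I - P) \<union> (P - I)) = Suc (card I)"
    unfolding P by (rule facts; fact prem1 prem2 prem3 prem4 prem5 prem6 prem7)+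
qed

end

section \<open>Running time of programs\<close>

text \<open>Total correctness with a time bound: existence of an execution includes
  termination.\<close>

definition run :: "(nat set \<Rightarrow> nat) \<Rightarrow> com \<Rightarrow> state \<Rightarrow> nat \<Rightarrow> (state \<Rightarrow> bool) \<Rightarrow> bool" where
  "run f P s B Q \<longleftrightarrow> (\<exists>t s'. exec f P s t s' \<and> t \<le> B \<and> Q s')"

primrec straight :: "com \<Rightarrow> bool" where
  "straight Skip \<longleftrightarrow> True"
| "straight (Assign x u) \<longleftrightarrow> True"
| "straight (Store a i u) \<longleftrightarrow> True"
| "straight (Query x a) \<longleftrightarrow> True"
| "straight (Seq P Q) \<longleftrightarrow> straight P \<and> straight Q"
| "straight (If b P Q) \<longleftrightarrow> straight P \<and> straight Q"
| "straight (While b P) \<longleftrightarrow> False"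

definition supp :: "(nat \<Rightarrow> nat) \<Rightarrow> nat set" where
  "supp v = {i. v i \<noteq> 0}"

text \<open>Meaningful for straight-line programs only; the values on loops are junk.\<close>

primrec sem :: "(nat set \<Rightarrow> nat) \<Rightarrow> com \<Rightarrow> state \<Rightarrow> state" where
  "sem f Skip s = s"
| "sem f (Assign x u) s = s\<lparr>reg := (reg s)(x := aval u s)\<rparr>"
| "sem f (Store a i u) s = s\<lparr>arr := (arr s)(a := (arr s a)(aval i s := aval u s))\<rparr>"
| "sem f (Query x a) s = s\<lparr>reg := (reg s)(x := f (supp (arr s a)))\<rparr>"
| "sem f (Seq P Q) s = sem f Q (sem f P s)"
| "sem f (If b P Q) s = (if bval b s then sem f P s else sem f Q s)"
| "sem f (While b P) s = s"

text \<open>Adding the costs of both branches bounds either one and lets \<open>simp\<close> compute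
  the bound. The value on loops is meaningless.\<close>

primrec ccost :: "com \<Rightarrow> nat" where
  "ccost Skip = 1"
| "ccost (Assign x u) = 1 + acost u"
| "ccost (Store a i u) = 1 + acost i + acost u"
| "ccost (Query x a) = 1"
| "ccost (Seq P Q) = ccost P + ccost Q"
| "ccost (If b P Q) = 1 + bcost b + ccost P + ccost Q"
| "ccost (While b P) = 0"

lemma exec_straight: "straight P \<Longrightarrow> \<exists>t. exec f P s t (sem f P s) \<and> t \<le> ccost P"
proof (induction P arbitrary: s)
  case (Seq P Q)
  then obtain t u where "exec f P s t (sem f P s)" "t \<le> ccost P"
    "exec f Q (sem f P s) u (sem f Q (sem f P s))" "u \<le> ccost Q" by fastforce
  then show ?case by (intro exI[of _ "t + u"]) (auto intro: exec.Seq)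
next
  case (If b P Q)
  then obtain t u where "exec f P s t (sem f P s)" "t \<le> ccost P"
    "exec f Q s u (sem f Q s)" "u \<le> ccost Q" by fastforce
  then show ?case
    using exec.IfTrue[of b s f P t "sem f P s" Q] exec.IfFalse[of b s f Q u "sem f Q s" P]
    by (cases "bval b s") force+
next
  case (Query x a)
  show ?case using exec.Query[of f x a s] by (auto simp: supp_def)
qed (auto intro: exec.Skip exec.Assign exec.Store simp del: One_nat_def)

lemma run_straight: "straight P \<Longrightarrow> ccost P \<le> B \<Longrightarrow> Q (sem f P s) \<Longrightarrow> run f P s B Q"
  unfolding run_def using exec_straight[of P f s] le_trans by blast

lemma run_weaken:
  "run f P s B Q \<Longrightarrow> B \<le> B' \<Longrightarrow> (\<And>s'. Q s' \<Longrightarrow> Q' s') \<Longrightarrow> run f P s B' Q'"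
  unfolding run_def using le_trans by blast

lemma run_Seq:
  assumes "run f P s B Q" "\<And>s'. Q s' \<Longrightarrow> run f P' s' B' Q'"
  shows "run f (Seq P P') s (B + B') Q'"
proof -
  obtain t s1 where 1: "exec f P s t s1" "t \<le> B" "Q s1" using assms(1) unfolding run_def by blast
  then obtain u s2 where 2: "exec f P' s1 u s2" "u \<le> B'" "Q' s2"
    using assms(2)[of s1] unfolding run_def by blast
  have "exec f (Seq P P') s (t + u) s2" by (rule exec.Seq[OF 1(1) 2(1)])
  then show ?thesis unfolding run_def using 1 2 add_mono by blast
qed

lemma run_If:
  assumes "bval b s \<Longrightarrow> run f P s B Q" "\<not> bval b s \<Longrightarrow> run f P' s B Q"
  shows "run f (If b P P') s (1 + bcost b + B) Q"
  using assms exec.IfTrue[of b s f P _ _ P'] exec.IfFalse[of b s f P' _ _ P]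
  unfolding run_def by (cases "bval b s") (meson add_left_mono)+

definition For :: "nat \<Rightarrow> com \<Rightarrow> com" where
  "For x P = Seq (Assign x (Const 0))
     (While (Less (Reg x) (Reg 0)) (Seq P (Assign x (Succ (Reg x)))))"

text \<open>The invariant ignores the counter \<open>x\<close>, which \<open>body\<close> tracks
  separately. A round costs 4 for the test and 3 for the increment besides the body; the extra round
  in the bound pays for the initialization and the last test.\<close>

lemma run_For:
  assumes Inv: "Inv 0 s"
    and bound: "\<And>i s. Inv i s \<Longrightarrow> reg s 0 = n"
    and indep: "\<And>i s v. Inv i s \<Longrightarrow> Inv i (s\<lparr>reg := (reg s)(x := v)\<rparr>)"
    and body: "\<And>i s. i < n \<Longrightarrow> Inv i s \<Longrightarrow> reg s x = i \<Longrightarrow>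
        run f P s B (\<lambda>s'. Inv (Suc i) s' \<and> reg s' x = i)"
  shows "run f (For x P) s ((n + 1) * (B + 7)) (Inv n)"
proof -
  let ?W = "While (Less (Reg x) (Reg 0)) (Seq P (Assign x (Succ (Reg x))))"
  have loop: "run f ?W s ((n - i) * (B + 7) + 4) (Inv n)"
    if "i \<le> n" "Inv i s" "reg s x = i" for i s
    using that
  proof (induction "n - i" arbitrary: i s)
    case 0
    then have "\<not> bval (Less (Reg x) (Reg 0)) s" using bound[of i s] by simp
    from exec.WhileFalse[OF this] have "exec f ?W s 4 s" by (simp add: eval_nat_numeral)
    then show ?case unfolding run_def using 0 by auto
  next
    case (Suc k)
    then have i: "i < n" and k: "k = n - Suc i" by simp_all
    obtain t s1 where 1: "exec f P s t s1" "t \<le> B" "Inv (Suc i) s1" "reg s1 x = i"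
      using body[OF i Suc.prems(2,3)] unfolding run_def by blast
    define s2 where "s2 = s1\<lparr>reg := (reg s1)(x := Suc i)\<rparr>"
    have "exec f (Assign x (Succ (Reg x))) s1 3 s2"
      using exec.Assign[of f x "Succ (Reg x)" s1] 1(4) by (simp add: s2_def eval_nat_numeral)
    then have 2: "exec f (Seq P (Assign x (Succ (Reg x)))) s (t + 3) s2"
      by (rule exec.Seq[OF 1(1)])
    have "Inv (Suc i) s2" "reg s2 x = Suc i" using indep[OF 1(3)] by (simp_all add: s2_def)
    then obtain u s3 where 3: "exec f ?W s2 u s3" "u \<le> (n - Suc i) * (B + 7) + 4" "Inv n s3"
      using Suc.hyps(1)[of "Suc i" s2] k i unfolding run_def by auto
    have "bval (Less (Reg x) (Reg 0)) s" using bound[OF Suc.prems(2)] Suc.prems(3) i by simp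
    from exec.WhileTrue[OF this 2 3(1)] have "exec f ?W s (4 + (t + 3) + u) s3"
      by (simp add: eval_nat_numeral)
    moreover have "4 + (t + 3) + u \<le> (n - i) * (B + 7) + 4"
    proof -
      have "(n - i) * (B + 7) = (B + 7) + (n - Suc i) * (B + 7)"
        using i by (metis Suc_diff_Suc mult_Suc)
      then show ?thesis using 1(2) 3(2) by linarith
    qed
    ultimately show ?case unfolding run_def using 3(3) by blast
  qed
  define s0 where "s0 = s\<lparr>reg := (reg s)(x := 0)\<rparr>"
  have 1: "exec f (Assign x (Const 0)) s 2 s0"
    using exec.Assign[of f x "Const 0" s] by (simp add: s0_def eval_nat_numeral)
  have "Inv 0 s0" "reg s0 x = 0" using indep[OF Inv] by (simp_all add: s0_def)
  from loop[OF _ this] obtain t s1 where 2: "exec f ?W s0 t s1" "t \<le> n * (B + 7) + 4" "Inv n s1"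
    unfolding run_def by auto
  have "exec f (For x P) s (2 + t) s1" unfolding For_def by (rule exec.Seq[OF 1 2(1)])
  moreover have "2 + t \<le> (n + 1) * (B + 7)" using 2(2) by simp
  ultimately show ?thesis unfolding run_def using 2(3) by blast
qed

section \<open>The program\<close>

text \<open>Input abbreviations leave numerals in the goals, so that the simplifier sees that two
  registers differ.\<close>

abbreviation (input) "rN \<equiv> 0::nat"
abbreviation (input) "rDone \<equiv> 2::nat"
abbreviation (input) "rAns \<equiv> 3::nat"
abbreviation (input) "rK \<equiv> 4::nat"
abbreviation (input) "rS \<equiv> 5::nat"
abbreviation (input) "rT \<equiv> 6::nat"
abbreviation (input) "rFound \<equiv> 7::nat"
abbreviation (input) "rLen \<equiv> 8::nat"
abbreviation (input) "rNS \<equiv> 9::nat"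
abbreviation (input) "rC \<equiv> 10::nat"
abbreviation (input) "rI \<equiv> 11::nat"
abbreviation (input) "rJ \<equiv> 12::nat"
abbreviation (input) "rX \<equiv> 13::nat"
abbreviation (input) "rRes \<equiv> 14::nat"

abbreviation (input) "aI \<equiv> 0::nat"
abbreviation (input) "aVis \<equiv> 2::nat"
abbreviation (input) "aQ \<equiv> 3::nat"
abbreviation (input) "aP \<equiv> 4::nat"

definition indic :: "nat set \<Rightarrow> nat \<Rightarrow> nat" where
  "indic I x = (if x \<in> I then 1 else 0)"

lemma supp_indic [simp]: "supp (indic I) = I"
  and indic_pos [simp]: "0 < indic I x \<longleftrightarrow> x \<in> I"
  and indic_eq_0 [simp]: "indic I x = 0 \<longleftrightarrow> x \<notin> I"
  and indic_insert [simp]: "(indic I)(x := Suc 0) = indic (insert x I)"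
  and indic_remove [simp]: "(indic I)(x := 0) = indic (I - {x})"
  by (auto simp: indic_def supp_def fun_eq_iff)

lemma state_upd_triv [simp]:
  "s\<lparr>reg := r, arr := arr s\<rparr> = s\<lparr>reg := r\<rparr>" "s\<lparr>arr := arr s\<rparr> = s"
  "arr s a = v \<Longrightarrow> (arr s)(a := v) = arr s"
  by auto

text \<open>The array of \<open>I\<close> is changed in place and restored, so that a query takes
  constant time without copying a set. Both elements may coincide.\<close>

definition insert_query :: "nat \<Rightarrow> nat \<Rightarrow> com" where
  "insert_query a b =
     Seq (Store aI (Reg a) (Const 1)) (Seq (Store aI (Reg b) (Const 1)) (Seq (Query rAns aI)
     (Seq (Store aI (Reg a) (Const 0)) (Store aI (Reg b) (Const 0)))))"

lemma sem_insert_query: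
  assumes "arr s aI = indic I" "reg s a \<notin> I" "reg s b \<notin> I" "a \<noteq> rAns" "b \<noteq> rAns"
  shows "sem f (insert_query a b) s =
    s\<lparr>reg := (reg s)(rAns := f (insert (reg s b) (insert (reg s a) I)))\<rparr>"
proof -
  have "insert (reg s b) (insert (reg s a) I) - {reg s a} - {reg s b} = I" using assms by auto
  then show ?thesis using assms by (simp add: insert_query_def)
qed

lemma insert_query_straight [simp]:
  "straight (insert_query a b)" "ccost (insert_query a b) = 13"
  by (simp_all add: insert_query_def)

definition link_query :: "nat \<Rightarrow> nat \<Rightarrow> nat \<Rightarrow> com" where
  "link_query a y x =
     Seq (Store aI (Reg y) (Const 0)) (Seq (Store aI (Reg a) (Const 1)) (Seq (Query rAns aI)
     (Seq (If (Eq (Reg rAns) (Reg rK))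
             (If (Eq (Reg x) (Reg a)) (Assign rRes (Const 1)) (Assign rRes (Const 0)))
             (Seq (Store aI (Reg x) (Const 1)) (Seq (Query rAns aI)
             (Seq (Store aI (Reg x) (Const 0))
             (If (Eq (Reg rAns) (Reg rK)) (Assign rRes (Const 1)) (Assign rRes (Const 0)))))))
     (Seq (Store aI (Reg a) (Const 0)) (Store aI (Reg y) (Const 1))))))"

lemma link_query_straight [simp]: "straight (link_query a y x)" "ccost (link_query a y x) = 40"
  by (simp_all add: link_query_def)

lemma sem_link_query:
  assumes "arr s aI = indic I" "reg s rK = card I" "reg s y \<in> I" "reg s x \<notin> I" "reg s a \<notin> I"
    and "{x, y, a} \<inter> {rAns, rRes} = {}"
  shows "\<exists>v. sem f (link_query a y x) s =
    s\<lparr>reg := (reg s)(rAns := v, rRes := if link f I (reg s a) (reg s y) (reg s x) then 1 else 0)\<rparr>"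
proof -
  let ?a = "reg s a" and ?x = "reg s x" and ?y = "reg s y"
  have "insert ?y (insert ?x (insert ?a (I - {?y})) - {?x} - {?a}) = I"
    "insert ?y (insert ?a (I - {?y}) - {?a}) = I"
    using assms(3-5) by auto
  then show ?thesis
    using assms(1,2,6) by (auto simp: link_query_def link_def)
qed

definition ctx :: "nat \<Rightarrow> nat set \<Rightarrow> state \<Rightarrow> bool" where
  "ctx n I s \<longleftrightarrow> reg s rN = n \<and> reg s rDone = 0 \<and> reg s rK = card I \<and> arr s aI = indic I"

definition greedy :: com where
  "greedy = For rI
     (If (Eq (Arr aI (Reg rI)) (Const 0))
       (Seq (Store aI (Reg rI) (Const 1)) (Seq (Query rAns aI)
       (If (Eq (Reg rAns) (Succ (Reg rK))) (Assign rK (Reg rAns)) (Store aI (Reg rI) (Const 0)))))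
       Skip)"

definition find_pair :: com where
  "find_pair = Seq (Assign rFound (Const 0)) (For rI (For rJ
     (If (And (Eq (Arr aI (Reg rI)) (Const 0)) (Eq (Arr aI (Reg rJ)) (Const 0)))
       (Seq (insert_query rJ rI)
       (If (Eq (Reg rAns) (Succ (Reg rK)))
         (Seq (Assign rS (Reg rI)) (Seq (Assign rT (Reg rJ)) (Assign rFound (Const 1)))) Skip))
       Skip)))"

definition init_queue :: com where
  "init_queue = Seq (Assign rLen (Const 0)) (Seq (For rI
     (If (Eq (Arr aI (Reg rI)) (Const 0))
       (Seq (insert_query rT rI)
       (If (Eq (Reg rAns) (Succ (Reg rK)))
         (Seq (Store aVis (Reg rI) (Const 1))
         (Seq (Store aQ (Reg rLen) (Reg rI)) (Assign rLen (Succ (Reg rLen)))))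
         (Store aVis (Reg rI) (Const 0))))
       (Store aVis (Reg rI) (Const 0))))
     (Assign rNS (Reg rLen)))"

definition edge_query :: com where
  "edge_query = Seq (Assign rX (Arr aQ (Reg rI))) (Seq (Assign rRes (Const 0))
     (If (Eq (Arr aI (Reg rX)) (Const 0))
       (If (Eq (Arr aI (Reg rJ)) (Const 0)) Skip (link_query rS rJ rX))
       (If (Eq (Arr aI (Reg rJ)) (Const 0)) (link_query rT rX rJ) Skip)))"

definition search :: com where
  "search = For rI (For rJ
     (If (And (Less (Reg rI) (Reg rLen)) (Eq (Arr aVis (Reg rJ)) (Const 0)))
       (Seq edge_query
       (If (Eq (Reg rRes) (Const 1))
         (Seq (Store aVis (Reg rJ) (Const 1)) (Seq (Store aQ (Reg rLen) (Reg rJ))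
         (Seq (Store aP (Reg rLen) (Reg rI)) (Assign rLen (Succ (Reg rLen))))))
         Skip))
       Skip))"

definition find_sink :: com where
  "find_sink = Seq (Assign rFound (Const 0)) (For rI
     (If (And (And (Eq (Reg rFound) (Const 0)) (Less (Reg rI) (Reg rLen)))
              (Eq (Arr aI (Arr aQ (Reg rI))) (Const 0)))
       (Seq (Assign rX (Arr aQ (Reg rI))) (Seq (insert_query rS rX)
       (If (Eq (Reg rAns) (Succ (Reg rK)))
         (Seq (Assign rC (Reg rI)) (Assign rFound (Const 1))) Skip)))
       Skip))"

definition flip :: com where
  "flip = Store aI (Arr aQ (Reg rC)) (Minus (Const 1) (Arr aI (Arr aQ (Reg rC))))"

text \<open>The loop always makes \<open>n\<close> rounds and idles once a source place is reached,
  so that \<open>run_For\<close> applies.\<close>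

definition flip_path :: com where
  "flip_path = Seq flip (For rI
     (If (Less (Reg rC) (Reg rNS)) Skip (Seq (Assign rC (Arr aP (Reg rC))) flip)))"

definition phase :: com where
  "phase = Seq (Query rK aI) (Seq greedy (Seq find_pair
     (If (Eq (Reg rFound) (Const 0)) (Assign rDone (Const 1))
       (Seq init_queue (Seq search (Seq find_sink
       (If (Eq (Reg rFound) (Const 0)) (Assign rDone (Const 1)) flip_path)))))))"

definition main :: com where
  "main = While (Eq (Reg rDone) (Const 0)) phase"

section \<open>Correctness of the program\<close>

text \<open>One pass suffices: common independence is hereditary, so a rejected element stays
  rejected when the set grows.\<close>

lemma run_greedy:
  assumes "matroid_pair {..<n} i1 i2 f" and s: "ctx n I s" and I: "common_indep i1 i2 I"
  shows "run f greedy s ((n + 1) * 50) (\<lambda>s'. \<exists>J. ctx n J s' \<and> common_indep i1 i2 J \<and> I \<subseteq> J \<and>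
           (\<forall>x<n. x \<notin> J \<longrightarrow> \<not> common_indep i1 i2 (insert x J)))"
proof -
  interpret matroid_pair "{..<n}" i1 i2 f by fact
  define Inv where "Inv i s \<longleftrightarrow> (\<exists>J. ctx n J s \<and> common_indep i1 i2 J \<and> I \<subseteq> J \<and>
      (\<forall>x<i. x \<notin> J \<longrightarrow> \<not> common_indep i1 i2 (insert x J)))" for i s
  \<comment> \<open>43 bounds the cost of every loop body that makes at most one query; with the
    loop overhead of 7 a round costs 50.\<close>
  have "run f greedy s ((n + 1) * (43 + 7)) (Inv n)"
    unfolding greedy_def
  proof (rule run_For[where Inv = Inv])
    show "Inv 0 s" using s I by (auto simp: Inv_def)
    show "reg s 0 = n" if "Inv i s" for i s using that by (auto simp: Inv_def ctx_def)
    show "Inv i (s\<lparr>reg := (reg s)(rI := v)\<rparr>)" if "Inv i s" for i s v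
      using that by (auto simp: Inv_def ctx_def)
  next
    fix i s assume i: "i < n" "Inv i s" "reg s rI = i"
    then obtain J where J: "ctx n J s" "common_indep i1 i2 J" "I \<subseteq> J"
      "\<And>x. x < i \<Longrightarrow> x \<notin> J \<Longrightarrow> \<not> common_indep i1 i2 (insert x J)"
      by (auto simp: Inv_def)
    have Jn: "J \<subseteq> {..<n}" "f J = card J" using J(2) common_indep_iff by auto
    then have fin: "finite J" using finite_subset by blast
    let ?P = "If (Eq (Arr aI (Reg rI)) (Const 0))
       (Seq (Store aI (Reg rI) (Const 1)) (Seq (Query rAns aI)
       (If (Eq (Reg rAns) (Succ (Reg rK))) (Assign rK (Reg rAns)) (Store aI (Reg rI) (Const 0)))))
       Skip"
    show "run f ?P s 43 (\<lambda>s'. Inv (Suc i) s' \<and> reg s' rI = i)"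
    proof (rule run_straight)
      consider "i \<in> J" | "i \<notin> J" "f (insert i J) = Suc (card J)"
        | "i \<notin> J" "f (insert i J) \<noteq> Suc (card J)" by blast
      then show "Inv (Suc i) (sem f ?P s) \<and> reg (sem f ?P s) rI = i"
      proof cases
        case 1
        then show ?thesis using J i by (auto simp: Inv_def ctx_def less_Suc_eq)
      next
        case 2
        then have "common_indep i1 i2 (insert i J)"
          using common_indep_iff i Jn fin by auto
        moreover have "\<not> common_indep i1 i2 (insert x (insert i J))" if "x < i" "x \<notin> J" for x
          using J(4)[OF that] common_indep_subset by blast
        moreover have "ctx n (insert i J) (sem f ?P s)"
          using 2 J(1) i(3) fin by (simp add: ctx_def)
        ultimately have "Inv (Suc i) (sem f ?P s)"
          unfolding Inv_def using J(3) by (intro exI[of _ "insert i J"]) (auto simp: less_Suc_eq)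
        then show ?thesis using 2 J(1) i(3) by (simp add: ctx_def)
      next
        case 3
        then have "\<not> common_indep i1 i2 (insert i J)" using common_indep_iff fin by auto
        moreover have "ctx n J (sem f ?P s)"
          using 3 J(1) i(3) by (simp add: ctx_def)
        ultimately have "Inv (Suc i) (sem f ?P s)"
          unfolding Inv_def using J by (intro exI[of _ J]) (auto simp: less_Suc_eq)
        then show ?thesis using 3 J(1) i(3) by (simp add: ctx_def)
      qed
    qed simp_all
  qed
  then show ?thesis unfolding Inv_def by simp
qed

lemma run_find_pair:
  assumes s: "ctx n I s"
  shows "run f find_pair s ((n + 1) * ((n + 1) * 50 + 7) + 2) (\<lambda>s'. ctx n I s' \<and>
      (reg s' rFound = 0 \<longrightarrow>
        (\<forall>a<n. \<forall>b<n. a \<notin> I \<and> b \<notin> I \<longrightarrow> f (insert a (insert b I)) \<noteq> Suc (card I))) \<and>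
      (reg s' rFound \<noteq> 0 \<longrightarrow> reg s' rS \<in> {..<n} - I \<and> reg s' rT \<in> {..<n} - I \<and>
        f (insert (reg s' rS) (insert (reg s' rT) I)) = Suc (card I)))"
proof -
  define Inv where "Inv i j s \<longleftrightarrow> ctx n I s \<and>
      (reg s rFound = 0 \<longrightarrow> (\<forall>a b. (a < i \<or> a = i \<and> b < j) \<and> b < n \<and> a \<notin> I \<and> b \<notin> I \<longrightarrow>
         f (insert a (insert b I)) \<noteq> Suc (card I))) \<and>
      (reg s rFound \<noteq> 0 \<longrightarrow> reg s rS \<in> {..<n} - I \<and> reg s rT \<in> {..<n} - I \<and>
        f (insert (reg s rS) (insert (reg s rT) I)) = Suc (card I))" for i j s
  have start: "run f (Assign rFound (Const 0)) s 2 (Inv 0 0)"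
    by (rule run_straight) (use s in \<open>auto simp: Inv_def ctx_def\<close>)
  let ?P = "If (And (Eq (Arr aI (Reg rI)) (Const 0)) (Eq (Arr aI (Reg rJ)) (Const 0)))
     (Seq (insert_query rJ rI)
     (If (Eq (Reg rAns) (Succ (Reg rK)))
       (Seq (Assign rS (Reg rI)) (Seq (Assign rT (Reg rJ)) (Assign rFound (Const 1)))) Skip))
     Skip"
  have loop: "run f (For rI (For rJ ?P)) s ((n + 1) * ((n + 1) * (43 + 7) + 7)) (Inv n 0)"
    if "Inv 0 0 s" for s
  proof (rule run_For[where Inv = "\<lambda>i. Inv i 0"])
    show "Inv 0 0 s" by fact
    show "reg s 0 = n" if "Inv i 0 s" for i s using that by (auto simp: Inv_def ctx_def)
    show "Inv i 0 (s\<lparr>reg := (reg s)(rI := v)\<rparr>)" if "Inv i 0 s" for i s v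
      using that unfolding Inv_def ctx_def by simp
  next
    fix i s assume i: "i < n" "Inv i 0 s" "reg s rI = i"
    show "run f (For rJ ?P) s ((n + 1) * (43 + 7)) (\<lambda>s'. Inv (Suc i) 0 s' \<and> reg s' rI = i)"
    proof (rule run_weaken[OF run_For[where Inv = "\<lambda>j s. Inv i j s \<and> reg s rI = i" and n = n]])
      show "Inv i 0 s \<and> reg s rI = i" using i by simp
      show "reg s 0 = n" if "Inv i j s \<and> reg s rI = i" for j s
        using that by (auto simp: Inv_def ctx_def)
      show "Inv i j (s\<lparr>reg := (reg s)(rJ := v)\<rparr>) \<and> reg (s\<lparr>reg := (reg s)(rJ := v)\<rparr>) rI = i"
        if "Inv i j s \<and> reg s rI = i" for j s v
        using that unfolding Inv_def ctx_def by simp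
      show "Inv (Suc i) 0 s' \<and> reg s' rI = i" if "Inv i n s' \<and> reg s' rI = i" for s'
        using that unfolding Inv_def less_Suc_eq by auto
    next
      fix j s assume j: "j < n" "Inv i j s \<and> reg s rI = i" "reg s rJ = j"
      then have c: "ctx n I s" by (simp add: Inv_def)
      show "run f ?P s 43 (\<lambda>s'. (Inv i (Suc j) s' \<and> reg s' rI = i) \<and> reg s' rJ = j)"
      proof (rule run_straight)
        show "(Inv i (Suc j) (sem f ?P s) \<and> reg (sem f ?P s) rI = i) \<and> reg (sem f ?P s) rJ = j"
        proof (cases "i \<in> I \<or> j \<in> I")
          case True
          then show ?thesis using j c by (auto simp: Inv_def ctx_def less_Suc_eq)
        next
          case False
          have "sem f (insert_query rJ rI) s =
              s\<lparr>reg := (reg s)(rAns := f (insert i (insert j I)))\<rparr>"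
            using sem_insert_query[of s I rJ rI f] c j False by (simp add: ctx_def)
          then show ?thesis
            using False j c i(1) by (auto simp: Inv_def ctx_def less_Suc_eq)
        qed
      qed simp_all
    qed simp
  qed
  show ?thesis
    unfolding find_pair_def
    by (rule run_weaken[OF run_Seq[OF start loop]]) (auto simp: Inv_def)
qed

section \<open>The search for a sink\<close>

definition sctx :: "nat \<Rightarrow> nat set \<Rightarrow> nat \<Rightarrow> nat \<Rightarrow> state \<Rightarrow> bool" where
  "sctx n I a b s \<longleftrightarrow> ctx n I s \<and> reg s rS = a \<and> reg s rT = b"

text \<open>Restricting to \<open>v < n\<close> lets the same predicate describe a partly
  initialized array: \<open>init_queue\<close> overwrites the entries left by the previous phase one
  by one.\<close>

definition visited :: "nat \<Rightarrow> state \<Rightarrow> bool" where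
  "visited n s \<longleftrightarrow> (\<forall>v<n. arr s aVis v \<noteq> 0 \<longleftrightarrow> v \<in> arr s aQ ` {..<reg s rLen})"

lemma image_upd_lessThan: "q(m := v) ` {..<Suc m} = insert v (q ` {..<m})"
  by (auto simp: lessThan_Suc image_iff)

lemma run_init_queue:
  assumes s: "sctx n I a b s" and b: "b \<notin> I"
  shows "run f init_queue s ((n + 1) * 50 + 4) (\<lambda>s'. sctx n I a b s' \<and> visited n s' \<and>
      reg s' rNS = reg s' rLen \<and> inj_on (arr s' aQ) {..<reg s' rLen} \<and>
      arr s' aQ ` {..<reg s' rLen} = partners f I b {..<n})"
proof -
  define Inv where "Inv i s \<longleftrightarrow> sctx n I a b s \<and> visited i s \<and>
      inj_on (arr s aQ) {..<reg s rLen} \<and>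
      arr s aQ ` {..<reg s rLen} = partners f I b {..<i}" for i s
  have start: "run f (Assign rLen (Const 0)) s 2 (Inv 0)"
    by (rule run_straight) (use s in \<open>auto simp: Inv_def sctx_def ctx_def visited_def partners_def\<close>)
  let ?P = "If (Eq (Arr aI (Reg rI)) (Const 0))
       (Seq (insert_query rT rI)
       (If (Eq (Reg rAns) (Succ (Reg rK)))
         (Seq (Store aVis (Reg rI) (Const 1))
         (Seq (Store aQ (Reg rLen) (Reg rI)) (Assign rLen (Succ (Reg rLen)))))
         (Store aVis (Reg rI) (Const 0))))
       (Store aVis (Reg rI) (Const 0))"
  have loop: "run f (For rI ?P) s ((n + 1) * (43 + 7)) (Inv n)" if "Inv 0 s" for s
  proof (rule run_For[where Inv = Inv])
    show "Inv 0 s" by fact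
    show "reg s 0 = n" if "Inv i s" for i s using that by (auto simp: Inv_def sctx_def ctx_def)
    show "Inv i (s\<lparr>reg := (reg s)(rI := v)\<rparr>)" if "Inv i s" for i s v
      using that unfolding Inv_def sctx_def ctx_def visited_def by simp
  next
    fix i s assume i: "i < n" "Inv i s" "reg s rI = i"
    then have c: "sctx n I a b s" and vis: "visited i s"
      and inj: "inj_on (arr s aQ) {..<reg s rLen}"
      and q: "arr s aQ ` {..<reg s rLen} = partners f I b {..<i}"
      by (simp_all add: Inv_def)
    have new: "i \<notin> arr s aQ ` {..<reg s rLen}" unfolding q partners_def by simp
    have upd: "partners f I b {..<Suc i} = (if i \<notin> I \<and> f (insert i (insert b I)) = Suc (card I)
        then insert i (partners f I b {..<i}) else partners f I b {..<i})"
      by (auto simp: partners_def less_Suc_eq)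
    have sq: "sem f (insert_query rT rI) s = s\<lparr>reg := (reg s)(rAns := f (insert i (insert b I)))\<rparr>"
      if "i \<notin> I"
      using sem_insert_query[of s I rT rI f] c i(3) b that by (simp add: sctx_def ctx_def)
    show "run f ?P s 43 (\<lambda>s'. Inv (Suc i) s' \<and> reg s' rI = i)"
    proof (rule run_straight)
      show "Inv (Suc i) (sem f ?P s) \<and> reg (sem f ?P s) rI = i"
      proof (cases "i \<notin> I \<and> f (insert i (insert b I)) = Suc (card I)")
        case True
        have "inj_on ((arr s aQ)(reg s rLen := i)) {..<Suc (reg s rLen)}"
          using inj new by (auto simp: inj_on_def less_Suc_eq image_iff)
        moreover have "(arr s aQ)(reg s rLen := i) ` {..<Suc (reg s rLen)} = partners f I b {..<Suc i}"
          unfolding image_upd_lessThan using True upd q by simp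
        moreover have "\<forall>v<Suc i. v \<noteq> i \<longrightarrow> (arr s aVis v \<noteq> 0 \<longleftrightarrow> v \<in> partners f I b {..<Suc i})"
          using vis upd True unfolding visited_def q by (auto simp: less_Suc_eq)
        moreover have "i \<in> partners f I b {..<Suc i}" using upd True by simp
        ultimately show ?thesis
          using True c i(3) sq by (simp add: Inv_def sctx_def ctx_def visited_def)
      next
        case False
        have "partners f I b {..<Suc i} = partners f I b {..<i}"
          using upd False by simp
        moreover have "\<forall>v<Suc i. v \<noteq> i \<longrightarrow> (arr s aVis v \<noteq> 0 \<longleftrightarrow> v \<in> partners f I b {..<i})"
          using vis unfolding visited_def q by (auto simp: less_Suc_eq)
        moreover have "i \<notin> partners f I b {..<i}" using new q by simp
        ultimately show ?thesis
          using False c i(3) sq inj q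
          by (cases "i \<in> I") (simp_all add: Inv_def sctx_def ctx_def visited_def)
      qed
    qed simp_all
  qed
  have fin: "run f (Assign rNS (Reg rLen)) s' 2 (\<lambda>s'. sctx n I a b s' \<and> visited n s' \<and>
      reg s' rNS = reg s' rLen \<and> inj_on (arr s' aQ) {..<reg s' rLen} \<and>
      arr s' aQ ` {..<reg s' rLen} = partners f I b {..<n})" if "Inv n s'" for s'
    by (rule run_straight) (use that in \<open>simp_all add: Inv_def sctx_def ctx_def visited_def\<close>)
  show ?thesis
    unfolding init_queue_def
    by (rule run_weaken[OF run_Seq[OF start run_Seq[OF loop fin]]]) auto
qed

lemma edge_query_straight [simp]: "straight edge_query" "ccost edge_query = 102"
  by (simp_all add: edge_query_def)

lemma sem_edge_query:
  assumes c: "sctx n I a b s" and ab: "a \<notin> I" "b \<notin> I"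
  shows "\<exists>v. sem f edge_query s = s\<lparr>reg := (reg s)(rX := arr s aQ (reg s rI), rAns := v,
    rRes := if edge f I a b (arr s aQ (reg s rI)) (reg s rJ) then 1 else 0)\<rparr>"
proof -
  let ?u = "arr s aQ (reg s rI)" and ?w = "reg s rJ"
  define s1 where "s1 = s\<lparr>reg := (reg s)(rX := ?u, rRes := 0)\<rparr>"
  have r: "arr s1 aI = indic I" "reg s1 rK = card I" "reg s1 rX = ?u" "reg s1 rJ = ?w"
    "reg s1 rS = a" "reg s1 rT = b"
    using c by (simp_all add: s1_def sctx_def ctx_def)
  have sem: "sem f edge_query s =
      (if ?u \<notin> I then if ?w \<notin> I then s1 else sem f (link_query rS rJ rX) s1
       else if ?w \<notin> I then sem f (link_query rT rX rJ) s1 else s1)"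
    using c by (auto simp: edge_query_def s1_def sctx_def ctx_def)
  consider "?u \<notin> I \<longleftrightarrow> ?w \<notin> I" | "?u \<notin> I" "?w \<in> I" | "?u \<in> I" "?w \<notin> I" by blast
  then show ?thesis
  proof cases
    case 1
    then have "\<not> edge f I a b ?u ?w" "sem f edge_query s = s1"
      using sem by (auto simp: edge_def)
    then show ?thesis
      by (intro exI[of _ "reg s rAns"]) (simp add: s1_def fun_upd_twist[of rX] fun_upd_idem)
  next
    case 2
    then obtain v where "sem f (link_query rS rJ rX) s1 =
        s1\<lparr>reg := (reg s1)(rAns := v, rRes := if link f I a ?w ?u then 1 else 0)\<rparr>"
      using sem_link_query[of s1 I rJ rX rS f] r ab by auto
    then show ?thesis
      using 2 sem by (intro exI[of _ v]) (simp add: s1_def edge_def fun_upd_twist)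
  next
    case 3
    then obtain v where "sem f (link_query rT rX rJ) s1 =
        s1\<lparr>reg := (reg s1)(rAns := v, rRes := if link f I b ?u ?w then 1 else 0)\<rparr>"
      using sem_link_query[of s1 I rX rJ rT f] r ab by auto
    then show ?thesis
      using 3 sem by (intro exI[of _ v]) (simp add: s1_def edge_def fun_upd_twist)
  qed
qed

text \<open>The outer loop runs over all \<open>n\<close> possible places and does nothing beyond
  the end of the queue. At the end every head is finished, since the queue has at most
  \<open>n\<close> entries.\<close>

lemma run_search:
  assumes s: "sctx n I a b s" and ab: "a \<notin> I" "b \<notin> I" and vis: "visited n s"
    and ns: "reg s rNS = reg s rLen" and inj: "inj_on (arr s aQ) {..<reg s rLen}"
    and src: "arr s aQ ` {..<reg s rLen} = partners f I b {..<n}"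
  shows "run f search s ((n + 1) * ((n + 1) * 150 + 7)) (\<lambda>s'. sctx n I a b s' \<and>
      bfs_inv (edge f I a b) (partners f I b {..<n}) n (arr s' aQ) (arr s' aP)
        (reg s' rNS) (reg s' rLen) n 0)"
proof -
  define Inv where "Inv h w s \<longleftrightarrow> sctx n I a b s \<and> visited n s \<and>
      bfs_inv (edge f I a b) (partners f I b {..<n}) n (arr s aQ) (arr s aP)
        (reg s rNS) (reg s rLen) h w" for h w s
  let ?P = "If (And (Less (Reg rI) (Reg rLen)) (Eq (Arr aVis (Reg rJ)) (Const 0)))
       (Seq edge_query
       (If (Eq (Reg rRes) (Const 1))
         (Seq (Store aVis (Reg rJ) (Const 1)) (Seq (Store aQ (Reg rLen) (Reg rJ))
         (Seq (Store aP (Reg rLen) (Reg rI)) (Assign rLen (Succ (Reg rLen))))))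
         Skip))
       Skip"
  have "run f (For rI (For rJ ?P)) s ((n + 1) * ((n + 1) * (143 + 7) + 7)) (Inv n 0)"
  proof (rule run_For[where Inv = "\<lambda>h. Inv h 0"])
    have "partners f I b {..<n} \<subseteq> {..<n}" by (auto simp: partners_def)
    then show "Inv 0 0 s"
      using s vis ns bfs_inv_start[OF inj src] by (simp add: Inv_def)
    show "reg s 0 = n" if "Inv h 0 s" for h s using that by (simp add: Inv_def sctx_def ctx_def)
    show "Inv h 0 (s\<lparr>reg := (reg s)(rI := v)\<rparr>)" if "Inv h 0 s" for h s v
      using that by (simp add: Inv_def sctx_def ctx_def visited_def)
  next
    fix h s assume h: "h < n" "Inv h 0 s" "reg s rI = h"
    show "run f (For rJ ?P) s ((n + 1) * (143 + 7)) (\<lambda>s'. Inv (Suc h) 0 s' \<and> reg s' rI = h)"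
    proof (rule run_weaken[OF run_For[where Inv = "\<lambda>w s. Inv h w s \<and> reg s rI = h" and n = n]])
      show "Inv h 0 s \<and> reg s rI = h" using h by simp
      show "reg s 0 = n" if "Inv h w s \<and> reg s rI = h" for w s
        using that by (simp add: Inv_def sctx_def ctx_def)
      show "Inv h w (s\<lparr>reg := (reg s)(rJ := v)\<rparr>) \<and> reg (s\<lparr>reg := (reg s)(rJ := v)\<rparr>) rI = h"
        if "Inv h w s \<and> reg s rI = h" for w s v
        using that by (simp add: Inv_def sctx_def ctx_def visited_def)
      show "Inv (Suc h) 0 s' \<and> reg s' rI = h" if "Inv h n s' \<and> reg s' rI = h" for s'
        using that bfs_inv_next_head unfolding Inv_def by auto
    next
      fix w s assume w: "w < n" "Inv h w s \<and> reg s rI = h" "reg s rJ = w"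
      then have c: "sctx n I a b s" and v: "visited n s"
        and inv: "bfs_inv (edge f I a b) (partners f I b {..<n}) n (arr s aQ) (arr s aP)
          (reg s rNS) (reg s rLen) h w" and rI: "reg s rI = h"
        by (simp_all add: Inv_def)
      have wv: "arr s aVis w \<noteq> 0 \<longleftrightarrow> w \<in> arr s aQ ` {..<reg s rLen}"
        using v w(1) by (simp add: visited_def)
      obtain u where eq: "sem f edge_query s = s\<lparr>reg := (reg s)(rX := arr s aQ h, rAns := u,
          rRes := if edge f I a b (arr s aQ h) w then 1 else 0)\<rparr>"
        using sem_edge_query[OF c ab] rI w(3) by auto
      show "run f ?P s 143 (\<lambda>s'. (Inv h (Suc w) s' \<and> reg s' rI = h) \<and> reg s' rJ = w)"
      proof (rule run_straight)
        \<comment> \<open>Either \<open>w\<close> is appended, or the search skips it because the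
          head is absent, there is no arc, or \<open>w\<close> is already in the queue.\<close>
        consider "h < reg s rLen" "arr s aVis w = 0" "edge f I a b (arr s aQ h) w"
          | "h < reg s rLen \<Longrightarrow> edge f I a b (arr s aQ h) w \<Longrightarrow> arr s aVis w \<noteq> 0" by blast
        then show "(Inv h (Suc w) (sem f ?P s) \<and> reg (sem f ?P s) rI = h) \<and> reg (sem f ?P s) rJ = w"
        proof cases
          case 1
          let ?q = "(arr s aQ)(reg s rLen := w)"
          have "bfs_inv (edge f I a b) (partners f I b {..<n}) n ?q
              ((arr s aP)(reg s rLen := h)) (reg s rNS) (Suc (reg s rLen)) h (Suc w)"
            using bfs_inv_add[OF inv w(1) _ 1(1,3)] wv 1(2) by simp
          moreover have "\<forall>v<n. v \<noteq> w \<longrightarrow> (arr s aVis v \<noteq> 0 \<longleftrightarrow> v \<in> ?q ` {..<Suc (reg s rLen)})"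
            unfolding image_upd_lessThan using v by (simp add: visited_def)
          moreover have "w \<in> ?q ` {..<Suc (reg s rLen)}" unfolding image_upd_lessThan by simp
          ultimately show ?thesis
            using 1 c rI w(3) eq by (simp add: Inv_def sctx_def ctx_def visited_def)
        next
          case 2
          have "bfs_inv (edge f I a b) (partners f I b {..<n}) n (arr s aQ) (arr s aP)
              (reg s rNS) (reg s rLen) h (Suc w)"
            by (rule bfs_inv_skip[OF inv]) (use 2 wv in blast)
          then show ?thesis
            using 2 c v rI w(3) eq by (auto simp: Inv_def sctx_def ctx_def visited_def)
        qed
      qed simp_all
    qed simp
  qed
  then show ?thesis
    unfolding search_def by (rule run_weaken) (simp_all add: Inv_def)
qed

text \<open>Once \<open>rFound\<close> is set the body does nothing, so \<open>rC\<close> keeps the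
  first sink in queue order.\<close>

lemma run_find_sink:
  assumes s: "sctx n I a b s" and a: "a \<notin> I"
    and q: "arr s aQ = q" "arr s aP = p" "reg s rNS = ns" "reg s rLen = len"
    and qn: "q ` {..<len} \<subseteq> {..<n}" and len: "len \<le> n"
  shows "run f find_sink s ((n + 1) * 50 + 2) (\<lambda>s'. sctx n I a b s' \<and>
      arr s' aQ = q \<and> arr s' aP = p \<and> reg s' rNS = ns \<and>
      (reg s' rFound = 0 \<longrightarrow> (\<forall>j<len. q j \<notin> partners f I a {..<n})) \<and>
      (reg s' rFound \<noteq> 0 \<longrightarrow> reg s' rC < len \<and> q (reg s' rC) \<in> partners f I a {..<n} \<and>
        (\<forall>j<reg s' rC. q j \<notin> partners f I a {..<n})))"
proof -
  define Inv where "Inv i s' \<longleftrightarrow> sctx n I a b s' \<and>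
      arr s' aQ = q \<and> arr s' aP = p \<and> reg s' rNS = ns \<and> reg s' rLen = len \<and>
      (reg s' rFound = 0 \<longrightarrow> (\<forall>j<i. j < len \<longrightarrow> q j \<notin> partners f I a {..<n})) \<and>
      (reg s' rFound \<noteq> 0 \<longrightarrow> reg s' rC < len \<and> q (reg s' rC) \<in> partners f I a {..<n} \<and>
        (\<forall>j<reg s' rC. q j \<notin> partners f I a {..<n}))" for i s'
  have start: "run f (Assign rFound (Const 0)) s 2 (Inv 0)"
    by (rule run_straight) (use s q in \<open>auto simp: Inv_def sctx_def ctx_def\<close>)
  let ?P = "If (And (And (Eq (Reg rFound) (Const 0)) (Less (Reg rI) (Reg rLen)))
              (Eq (Arr aI (Arr aQ (Reg rI))) (Const 0)))
       (Seq (Assign rX (Arr aQ (Reg rI))) (Seq (insert_query rS rX)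
       (If (Eq (Reg rAns) (Succ (Reg rK)))
         (Seq (Assign rC (Reg rI)) (Assign rFound (Const 1))) Skip)))
       Skip"
  have loop: "run f (For rI ?P) s ((n + 1) * (43 + 7)) (Inv n)" if "Inv 0 s" for s
  proof (rule run_For[where Inv = Inv])
    show "Inv 0 s" by fact
    show "reg s 0 = n" if "Inv i s" for i s using that by (simp add: Inv_def sctx_def ctx_def)
    show "Inv i (s\<lparr>reg := (reg s)(rI := v)\<rparr>)" if "Inv i s" for i s v
      using that by (simp add: Inv_def sctx_def ctx_def)
  next
    fix i s assume i: "i < n" "Inv i s" "reg s rI = i"
    then have c: "sctx n I a b s" and r: "arr s aQ = q" "reg s rLen = len"
      by (simp_all add: Inv_def)
    show "run f ?P s 43 (\<lambda>s'. Inv (Suc i) s' \<and> reg s' rI = i)"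
    proof (rule run_straight)
      show "Inv (Suc i) (sem f ?P s) \<and> reg (sem f ?P s) rI = i"
      proof (cases "reg s rFound = 0 \<and> i < len \<and> q i \<notin> I")
        case True
        let ?s = "s\<lparr>reg := (reg s)(rX := q i)\<rparr>"
        have eq: "sem f (insert_query rS rX) ?s =
            ?s\<lparr>reg := (reg ?s)(rAns := f (insert (q i) (insert a I)))\<rparr>"
          using sem_insert_query[of ?s I rS rX f] True c a by (simp add: sctx_def ctx_def)
        have qi: "q i \<in> partners f I a {..<n} \<longleftrightarrow> f (insert (q i) (insert a I)) = Suc (card I)"
          using qn True by (auto simp: partners_def)
        have sem: "sem f ?P s = (if q i \<in> partners f I a {..<n}
            then ?s\<lparr>reg := (reg ?s)(rAns := Suc (card I), rC := i, rFound := 1)\<rparr>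
            else ?s\<lparr>reg := (reg ?s)(rAns := f (insert (q i) (insert a I)))\<rparr>)"
          using True c i(3) r eq unfolding qi by (simp add: sctx_def ctx_def)
        show ?thesis
          unfolding sem using True i(2,3) by (auto simp: Inv_def sctx_def ctx_def less_Suc_eq)
      next
        case False
        then have "sem f ?P s = s"
          using c i(3) r by (auto simp: sctx_def ctx_def)
        moreover have "Inv (Suc i) s"
          using i(2) False by (auto simp: Inv_def less_Suc_eq partners_def)
        ultimately show ?thesis using i(3) by simp
      qed
    qed simp_all
  qed
  show ?thesis
    unfolding find_sink_def
    by (rule run_weaken[OF run_Seq[OF start loop]]) (use len in \<open>auto simp: Inv_def\<close>)
qed

section \<open>Symmetric difference with the search path\<close>

lemma indic_flip:
  "x \<notin> P \<Longrightarrow> (indic ((I - P) \<union> (P - I)))(x := 1 - indic ((I - P) \<union> (P - I)) x) =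
    indic ((I - insert x P) \<union> (insert x P - I))"
  by (auto simp: indic_def fun_eq_iff)

lemma flip_straight [simp]: "straight flip" "ccost flip = 8"
  by (simp_all add: flip_def)

lemma run_flip_path:
  assumes s: "sctx n I a b s" and q: "arr s aQ = q" "arr s aP = pp" "reg s rNS = ns" "reg s rC = c"
    and path: "search_path pp ns c p m" and inj: "inj_on q {..c}" and c: "c < n"
  shows "run f flip_path s ((n + 1) * 50 + 8) (\<lambda>s'. reg s' rN = n \<and> reg s' rDone = 0 \<and>
      arr s' aI = indic ((I - q ` p ` {..m}) \<union> (q ` p ` {..m} - I)))"
proof -
  define X where "X l = q ` p ` {l..m}" for l
  \<comment> \<open>After \<open>i\<close> rounds the vertices from index \<open>m - i\<close> on
    are flipped. Truncated subtraction keeps the invariant true in the idle rounds, when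
    \<open>m - i\<close> is 0.\<close>
  define Inv where "Inv i s' \<longleftrightarrow> reg s' rN = n \<and> reg s' rDone = 0 \<and>
      arr s' aQ = q \<and> arr s' aP = pp \<and> reg s' rNS = ns \<and> reg s' rC = p (m - i) \<and>
      arr s' aI = indic ((I - X (m - i)) \<union> (X (m - i) - I))" for i and s' :: state
  have pm: "p m = c" and p0: "p 0 < ns"
    and step: "\<And>l. l < m \<Longrightarrow> p l = pp (p (Suc l)) \<and> ns \<le> p (Suc l)"
    using path unfolding search_path_def by auto
  have Xm: "X m = {q c}" using pm by (simp add: X_def)
  \<comment> \<open>Each vertex must be toggled only once; distinct places hold distinct
    vertices.\<close>
  have new: "q (p l) \<notin> X (Suc l)" if l: "l < m" for l
  proof
    assume "q (p l) \<in> X (Suc l)"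
    then obtain k where k: "l < k" "k \<le> m" "q (p l) = q (p k)" by (auto simp: X_def Suc_le_eq)
    then have "p l < p k" using search_path_less[OF path] by blast
    moreover have "p k \<le> c" using search_path_less[OF path, of k m] k pm by (cases "k = m") auto
    ultimately show False using inj_onD[OF inj k(3)] by auto
  qed
  have X_Suc: "X l = insert (q (p l)) (X (Suc l))" if l: "l < m" for l
    using l by (auto simp: X_def Icc_eq_insert_lb_nat)
  have start: "run f flip s 8 (Inv 0)"
  proof (rule run_straight)
    have "(indic I)(q c := 1 - indic I (q c)) = indic ((I - {q c}) \<union> ({q c} - I))"
      using indic_flip[of "q c" "{}" I] by simp
    then show "Inv 0 (sem f flip s)"
      using s q pm Xm by (simp add: Inv_def flip_def sctx_def ctx_def)
  qed simp_all
  let ?P = "If (Less (Reg rC) (Reg rNS)) Skip (Seq (Assign rC (Arr aP (Reg rC))) flip)"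
  have loop: "run f (For rI ?P) s ((n + 1) * (43 + 7)) (Inv n)" if "Inv 0 s" for s
  proof (rule run_For[where Inv = Inv])
    show "Inv 0 s" by fact
    show "reg s 0 = n" if "Inv i s" for i s using that by (simp add: Inv_def)
    show "Inv i (s\<lparr>reg := (reg s)(rI := v)\<rparr>)" if "Inv i s" for i s v
      using that by (simp add: Inv_def)
  next
    fix i s assume i: "i < n" "Inv i s" "reg s rI = i"
    show "run f ?P s 43 (\<lambda>s'. Inv (Suc i) s' \<and> reg s' rI = i)"
    proof (rule run_straight)
      show "Inv (Suc i) (sem f ?P s) \<and> reg (sem f ?P s) rI = i"
      proof (cases "i < m")
        case False
        then show ?thesis using i p0 by (simp add: Inv_def)
      next
        case True
        define l where "l = m - Suc i"
        have l: "l < m" "m - i = Suc l" "m - Suc i = l" using True by (auto simp: l_def)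
        have pl: "pp (p (Suc l)) = p l" "\<not> p (Suc l) < ns" using step[OF l(1)] by auto
        show ?thesis
          using i l pl indic_flip[OF new[OF l(1)], of I] X_Suc[OF l(1)]
          by (simp add: Inv_def flip_def)
      qed
    qed simp_all
  qed
  have "m - n = 0" using search_path_length[OF path] c by simp
  then have fin: "arr s' aI = indic ((I - q ` p ` {..m}) \<union> (q ` p ` {..m} - I))" if "Inv n s'" for s'
    using that by (simp add: Inv_def X_def atMost_atLeast0)
  show ?thesis
    unfolding flip_path_def
    by (rule run_weaken[OF run_Seq[OF start loop]]) (use fin in \<open>auto simp: Inv_def\<close>)
qed

section \<open>Effect and cost of a phase\<close>

lemma run_augment:
  assumes "exchange_graph {..<n} i1 i2 f I a b" and ctx: "sctx n I a b s"
  shows "run f (Seq init_queue (Seq search (Seq find_sink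
        (If (Eq (Reg rFound) (Const 0)) (Assign rDone (Const 1)) flip_path)))) s (350 * (n + 1)\<^sup>2)
      (\<lambda>s'. reg s' rN = n \<and> (\<exists>J. arr s' aI = indic J \<and>
        (reg s' rDone = 0 \<and> common_indep i1 i2 J \<and> card I < card J \<or>
         reg s' rDone = 1 \<and> max_common_indep i1 i2 J)))"
    (is "run f ?P s _ ?Q")
proof -
  interpret exchange_graph "{..<n}" i1 i2 f I a b by fact
  have ab: "a \<notin> I" "b \<notin> I" using s t by auto
  let ?k = "n + 1"
  let ?bfs = "bfs_inv (edge f I a b) (partners f I b {..<n}) n"
  have search: "run f search s' (?k * (?k * 150 + 7)) (\<lambda>s'. sctx n I a b s' \<and>
      ?bfs (arr s' aQ) (arr s' aP) (reg s' rNS) (reg s' rLen) n 0)"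
    if "sctx n I a b s' \<and> visited n s' \<and> reg s' rNS = reg s' rLen \<and>
      inj_on (arr s' aQ) {..<reg s' rLen} \<and> arr s' aQ ` {..<reg s' rLen} = partners f I b {..<n}" for s'
    using that run_search[of n I a b s' f] ab by blast
  have sink: "run f (Seq find_sink
        (If (Eq (Reg rFound) (Const 0)) (Assign rDone (Const 1)) flip_path)) s1
      ((?k * 50 + 2) + (4 + (?k * 50 + 8))) ?Q"
    if s1: "sctx n I a b s1 \<and> ?bfs (arr s1 aQ) (arr s1 aP) (reg s1 rNS) (reg s1 rLen) n 0" for s1
  proof -
    define q pp ns len where "q = arr s1 aQ" and "pp = arr s1 aP" and "ns = reg s1 rNS"
      and "len = reg s1 rLen"
    have inv: "?bfs q pp ns len n 0" using s1 by (simp add: q_def pp_def ns_def len_def)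
    have len: "len \<le> n" by (rule bfs_inv_len_le[OF inv])
    interpret finished_search n i1 i2 f I a b q pp ns len n
      by unfold_locales (use inv len in auto)
    have sc: "sctx n I a b s1" using s1 by simp
    let ?Q' = "\<lambda>s'. sctx n I a b s' \<and> arr s' aQ = q \<and> arr s' aP = pp \<and> reg s' rNS = ns \<and>
      (reg s' rFound = 0 \<longrightarrow> (\<forall>j<len. q j \<notin> partners f I a {..<n})) \<and>
      (reg s' rFound \<noteq> 0 \<longrightarrow> reg s' rC < len \<and> q (reg s' rC) \<in> partners f I a {..<n} \<and>
        (\<forall>j<reg s' rC. q j \<notin> partners f I a {..<n}))"
    have 1: "run f find_sink s1 (?k * 50 + 2) ?Q'"
      by (rule run_find_sink[OF sc ab(1)]) (use q_less len in \<open>auto simp: q_def pp_def ns_def len_def\<close>)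
    have 2: "run f (If (Eq (Reg rFound) (Const 0)) (Assign rDone (Const 1)) flip_path) s2
        (1 + bcost (Eq (Reg rFound) (Const 0)) + (?k * 50 + 8)) ?Q" if s2: "?Q' s2" for s2
    proof (rule run_If)
      assume "bval (Eq (Reg rFound) (Const 0)) s2"
      then have "max_common_indep i1 i2 I" using s2 max_if_no_sink by auto
      then show "run f (Assign rDone (Const 1)) s2 (?k * 50 + 8) ?Q"
        by (intro run_straight) (use s2 in \<open>auto simp: sctx_def ctx_def\<close>)
    next
      assume "\<not> bval (Eq (Reg rFound) (Const 0)) s2"
      then have c: "reg s2 rC < len" "q (reg s2 rC) \<in> partners f I a {..<n}"
        "\<And>j. j < reg s2 rC \<Longrightarrow> q j \<notin> partners f I a {..<n}"
        using s2 by auto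
      obtain p m where path: "search_path pp ns (reg s2 rC) p m"
        using search_path_exists[OF inv c(1)] by blast
      have "inj_on q {..reg s2 rC}" by (rule inj_on_subset[OF inj]) (use c in auto)
      then have "run f flip_path s2 (?k * 50 + 8) (\<lambda>s'. reg s' rN = n \<and> reg s' rDone = 0 \<and>
          arr s' aI = indic ((I - q ` p ` {..m}) \<union> (q ` p ` {..m} - I)))"
        using s2 path c(1) len by (intro run_flip_path[where c = "reg s2 rC"]) auto
      then show "run f flip_path s2 (?k * 50 + 8) ?Q"
        by (rule run_weaken) (use augment_search_path[OF c path] in auto)
    qed
    have "run f (Seq find_sink (If (Eq (Reg rFound) (Const 0)) (Assign rDone (Const 1)) flip_path)) s1
      ((?k * 50 + 2) + (1 + bcost (Eq (Reg rFound) (Const 0)) + (?k * 50 + 8))) ?Q"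
      by (rule run_Seq[OF 1 2])
    then show ?thesis by (simp add: numeral_eq_Suc)
  qed
  have "run f ?P s ((?k * 50 + 4) + (?k * (?k * 150 + 7) + ((?k * 50 + 2) + (4 + (?k * 50 + 8))))) ?Q"
    by (rule run_Seq[OF run_init_queue[OF ctx ab(2)] run_Seq[OF search sink]])
  moreover have "(?k * 50 + 4) + (?k * (?k * 150 + 7) + ((?k * 50 + 2) + (4 + (?k * 50 + 8)))) \<le> 350 * ?k\<^sup>2"
  proof -
    have "?k * 1 \<le> ?k * ?k" by (rule mult_le_mono) auto
    moreover have "1 \<le> ?k * ?k" by simp
    moreover have "?k * (?k * 150 + 7) = 150 * (?k * ?k) + 7 * ?k" by (simp add: algebra_simps)
    ultimately show ?thesis unfolding power2_eq_square by linarith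
  qed
  ultimately show ?thesis by (rule run_weaken) auto
qed

lemma run_phase:
  assumes mp: "matroid_pair {..<n} i1 i2 f"
    and s: "reg s rN = n" "reg s rDone = 0" "arr s aI = indic I" and I: "common_indep i1 i2 I"
  shows "run f phase s (500 * (n + 1)\<^sup>2)
      (\<lambda>s'. reg s' rN = n \<and> (\<exists>J. arr s' aI = indic J \<and>
        (reg s' rDone = 0 \<and> common_indep i1 i2 J \<and> card I < card J \<or>
         reg s' rDone = 1 \<and> max_common_indep i1 i2 J)))"
    (is "run f _ s _ ?Q")
proof -
  interpret matroid_pair "{..<n}" i1 i2 f by fact
  let ?k = "n + 1"
  have "f I = card I" using I common_indep_iff by blast
  then have query: "run f (Query rK aI) s 1 (ctx n I)"
    by (intro run_straight) (use s in \<open>simp_all add: ctx_def\<close>)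
  let ?A = "If (Eq (Reg rFound) (Const 0)) (Assign rDone (Const 1))
       (Seq init_queue (Seq search (Seq find_sink
       (If (Eq (Reg rFound) (Const 0)) (Assign rDone (Const 1)) flip_path))))"
  have rest: "run f (Seq find_pair ?A) s1 ((?k * (?k * 50 + 7) + 2) +
      (1 + bcost (Eq (Reg rFound) (Const 0)) + 350 * ?k\<^sup>2)) ?Q"
    if s1: "\<exists>J. ctx n J s1 \<and> common_indep i1 i2 J \<and> I \<subseteq> J \<and>
      (\<forall>x<n. x \<notin> J \<longrightarrow> \<not> common_indep i1 i2 (insert x J))" for s1
  proof -
    obtain J where c: "ctx n J s1" and J: "common_indep i1 i2 J" "I \<subseteq> J"
      and max: "\<And>x. x \<in> {..<n} - J \<Longrightarrow> \<not> common_indep i1 i2 (insert x J)"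
      using s1 by blast
    have "finite J" using J(1) common_indep_iff finite_subset by blast
    then have card: "card I \<le> card J" using J(2) card_mono by blast
    show ?thesis
    proof (rule run_Seq[OF run_find_pair[OF c]], rule run_If)
      fix s2
      assume s2: "ctx n J s2 \<and>
        (reg s2 rFound = 0 \<longrightarrow>
          (\<forall>a<n. \<forall>b<n. a \<notin> J \<and> b \<notin> J \<longrightarrow> f (insert a (insert b J)) \<noteq> Suc (card J))) \<and>
        (reg s2 rFound \<noteq> 0 \<longrightarrow> reg s2 rS \<in> {..<n} - J \<and> reg s2 rT \<in> {..<n} - J \<and>
          f (insert (reg s2 rS) (insert (reg s2 rT) J)) = Suc (card J))"
      {
        assume "bval (Eq (Reg rFound) (Const 0)) s2"
        then have "max_common_indep i1 i2 J"
          by (intro max_if_no_pair[OF J(1) max]) (use s2 in auto)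
        then have "run f (Assign rDone (Const 1)) s2 2 ?Q"
          by (intro run_straight) (use s2 in \<open>auto simp: ctx_def\<close>)
        then show "run f (Assign rDone (Const 1)) s2 (350 * ?k\<^sup>2) ?Q"
          by (rule run_weaken) (simp_all add: power2_eq_square)
      next
        assume "\<not> bval (Eq (Reg rFound) (Const 0)) s2"
        then have st: "reg s2 rS \<in> {..<n} - J" "reg s2 rT \<in> {..<n} - J"
          "f (insert (reg s2 rS) (insert (reg s2 rT) J)) = Suc (card J)" using s2 by simp_all
        have sc: "sctx n J (reg s2 rS) (reg s2 rT) s2" using s2 by (simp add: sctx_def)
        \<comment> \<open>The goal is symmetric in the matroids, so the swapped exchange graph gives
          the same result.\<close>
        have comm: "common_indep i2 i1 = common_indep i1 i2"
          "max_common_indep i2 i1 = max_common_indep i1 i2"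
          by (auto simp: fun_eq_iff common_indep_def max_common_indep_def)
        have "exchange_graph {..<n} i1 i2 f J (reg s2 rS) (reg s2 rT) \<or>
            exchange_graph {..<n} i2 i1 f J (reg s2 rS) (reg s2 rT)"
          by (rule pair_exchange_graph[OF J(1) max st])
        then show "run f (Seq init_queue (Seq search (Seq find_sink
            (If (Eq (Reg rFound) (Const 0)) (Assign rDone (Const 1)) flip_path)))) s2 (350 * ?k\<^sup>2) ?Q"
        proof
          assume "exchange_graph {..<n} i1 i2 f J (reg s2 rS) (reg s2 rT)"
          from run_augment[OF this sc] show ?thesis
            by (rule run_weaken) (use card in auto)
        next
          assume "exchange_graph {..<n} i2 i1 f J (reg s2 rS) (reg s2 rT)"
          from run_augment[OF this sc, unfolded comm] show ?thesis
            by (rule run_weaken) (use card in auto)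
        qed
      }
    qed
  qed
  have "run f phase s (1 + (?k * 50 + ((?k * (?k * 50 + 7) + 2) +
      (1 + bcost (Eq (Reg rFound) (Const 0)) + 350 * ?k\<^sup>2)))) ?Q"
    unfolding phase_def by (rule run_Seq[OF query run_Seq[OF run_greedy[OF mp _ I] rest]])
  moreover have "1 + (?k * 50 + ((?k * (?k * 50 + 7) + 2) +
      (1 + bcost (Eq (Reg rFound) (Const 0)) + 350 * ?k\<^sup>2))) \<le> 500 * ?k\<^sup>2"
  proof -
    have "?k * 1 \<le> ?k * ?k" by (rule mult_le_mono) auto
    moreover have "1 \<le> ?k * ?k" by simp
    moreover have "?k * (?k * 50 + 7) = 50 * (?k * ?k) + 7 * ?k" by (simp add: algebra_simps)
    moreover have "bcost (Eq (Reg rFound) (Const 0)) = 3" by simp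
    ultimately show ?thesis unfolding power2_eq_square by linarith
  qed
  ultimately show ?thesis by (rule run_weaken) auto
qed

text \<open>Every phase but the last enlarges the set, so there are at most
  \<open>R - card I + 1\<close> phases. Each pays 4 for its test of \<open>rDone\<close>, as does
  the final failing test.\<close>

lemma run_main:
  assumes mp: "matroid_pair {..<n} i1 i2 f"
    and s: "reg s rN = n" "reg s rDone = 0" "arr s aI = indic I" and I: "common_indep i1 i2 I"
    and R: "\<And>J. common_indep i1 i2 J \<Longrightarrow> card J \<le> R"
  shows "run f main s ((R - card I + 1) * (500 * (n + 1)\<^sup>2 + 4) + 4)
      (\<lambda>s'. \<exists>J. arr s' aI = indic J \<and> max_common_indep i1 i2 J)"
  using s I
proof (induction "R - card I" arbitrary: I s rule: less_induct)
  case less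
  let ?B = "500 * (n + 1)\<^sup>2" and ?b = "Eq (Reg rDone) (Const 0)"
  obtain t s1 J where 1: "exec f phase s t s1" "t \<le> ?B" and J: "reg s1 rN = n" "arr s1 aI = indic J"
    "reg s1 rDone = 0 \<and> common_indep i1 i2 J \<and> card I < card J \<or>
     reg s1 rDone = 1 \<and> max_common_indep i1 i2 J"
    using run_phase[OF mp less.prems] unfolding run_def by blast
  have "bval ?b s" using less.prems by simp
  note step = exec.WhileTrue[OF this 1(1)]
  from J(3) show ?case
  proof
    assume *: "reg s1 rDone = 0 \<and> common_indep i1 i2 J \<and> card I < card J"
    then have lt: "R - card J < R - card I" using R[of J] by (simp add: diff_less_mono2)
    from * have "reg s1 rDone = 0" "common_indep i1 i2 J" by auto
    from less.hyps[OF lt J(1) this(1) J(2) this(2)] obtain u s2 K where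
      2: "exec f main s1 u s2" "u \<le> (R - card J + 1) * (?B + 4) + 4"
        "arr s2 aI = indic K" "max_common_indep i1 i2 K"
      unfolding run_def by blast
    have "exec f main s (4 + t + u) s2"
      using step[of u s2] 2(1) unfolding main_def by (simp add: eval_nat_numeral)
    moreover have "4 + t + u \<le> (R - card I + 1) * (?B + 4) + 4"
    proof -
      have "(R - card J + 1 + 1) * (?B + 4) \<le> (R - card I + 1) * (?B + 4)"
        using lt by (intro mult_right_mono) auto
      then show ?thesis using 1(2) 2(2) by simp
    qed
    ultimately show ?thesis unfolding run_def using 2(3,4) by blast
  next
    assume *: "reg s1 rDone = 1 \<and> max_common_indep i1 i2 J"
    then have "\<not> bval ?b s1" by simp
    from step[OF exec.WhileFalse[OF this]] have "exec f main s (4 + t + 4) s1"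
      unfolding main_def by (simp add: eval_nat_numeral)
    moreover have "4 + t + 4 \<le> (R - card I + 1) * (?B + 4) + 4"
      using 1(2) by simp
    ultimately show ?thesis unfolding run_def using * J(2) by blast
  qed
qed

section \<open>Numbering the ground set\<close>

locale numbered =
  fixes e :: "nat \<Rightarrow> 'a" and n :: nat and E :: "'a set"
  assumes bij: "bij_betw e {..<n} E"
begin

text \<open>The program handles numbers, so the matroids are carried over to \<open>{..<n}\<close>
  along \<open>e\<close>; ranks and maximality are preserved.\<close>

definition pull :: "('a set \<Rightarrow> bool) \<Rightarrow> nat set \<Rightarrow> bool" where
  "pull ind X \<longleftrightarrow> X \<subseteq> {..<n} \<and> ind (e ` X)"

lemma inj: "inj_on e {..<n}" and image: "e ` {..<n} = E"
  using bij by (auto simp: bij_betw_def)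

lemma card_image_e: "X \<subseteq> {..<n} \<Longrightarrow> card (e ` X) = card X"
  using inj by (intro card_image) (rule inj_on_subset)

lemma matroid_pull:
  assumes "matroid E ind"
  shows "matroid {..<n} (pull ind)"
proof -
  interpret matroid E ind by fact
  show ?thesis
  proof
    show "pull ind {}" using indep_empty by (simp add: pull_def)
    show "pull ind Y" if "pull ind X" "Y \<subseteq> X" for X Y
      using that indep_subset[of "e ` X" "e ` Y"] by (auto simp: pull_def)
  next
    fix X Y assume XY: "pull ind X" "pull ind Y" "card X < card Y"
    then have "card (e ` X) < card (e ` Y)" using card_image_e by (simp add: pull_def)
    with XY augment[of "e ` X" "e ` Y"]
    obtain z where "z \<in> e ` Y - e ` X" "ind (insert z (e ` X))"
      unfolding pull_def by blast
    then obtain y where "y \<in> Y - X" "ind (e ` insert y X)" by auto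
    then show "\<exists>y\<in>Y - X. pull ind (insert y X)"
      using XY by (intro bexI[of _ y]) (auto simp: pull_def)
  qed (simp_all add: pull_def)
qed

lemma rank_pull:
  assumes "X \<subseteq> {..<n}"
  shows "rank (pull ind) X = rank ind (e ` X)"
proof -
  have "{card I |I. I \<subseteq> X \<and> pull ind I} = {card I |I. I \<subseteq> e ` X \<and> ind I}" (is "?L = ?R")
  proof
    show "?L \<subseteq> ?R"
    proof
      fix c assume "c \<in> ?L"
      then obtain I where "c = card I" "I \<subseteq> X" "pull ind I" by blast
      then have "c = card (e ` I)" "e ` I \<subseteq> e ` X" "ind (e ` I)"
        using card_image_e by (auto simp: pull_def)
      then show "c \<in> ?R" by blast
    qed
    show "?R \<subseteq> ?L"
    proof
      fix c assume "c \<in> ?R"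
      then obtain I where I: "c = card I" "I \<subseteq> e ` X" "ind I" by blast
      then obtain J where J: "J \<subseteq> X" "I = e ` J" by (auto simp: subset_image_iff)
      then have "c = card J" "pull ind J" using I assms card_image_e by (auto simp: pull_def)
      then show "c \<in> ?L" using J by blast
    qed
  qed
  then show ?thesis unfolding rank_def by simp
qed

lemma decode_eq: "X \<subseteq> {..<n} \<Longrightarrow> decode e n X = e ` X"
  unfolding decode_def by (rule arg_cong[of _ _ "image e"]) auto

lemma matroid_pair_pull:
  assumes "matroid E ind1" "matroid E ind2"
  shows "matroid_pair {..<n} (pull ind1) (pull ind2) (\<lambda>X. min_rank ind1 ind2 (decode e n X))"
  using assms
  by (intro matroid_pair.intro matroid_pull matroid_pair_axioms.intro)
    (simp_all add: min_rank_def rank_pull decode_eq)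

lemma common_pull:
  "common_indep (pull ind1) (pull ind2) X \<longleftrightarrow> X \<subseteq> {..<n} \<and> common_indep ind1 ind2 (e ` X)"
  by (auto simp: common_indep_def pull_def)

lemma max_common_pull:
  assumes m: "matroid E ind1" and J: "max_common_indep (pull ind1) (pull ind2) J"
  shows "max_common_indep ind1 ind2 (decode e n J)"
proof -
  have Jn: "J \<subseteq> {..<n}" "common_indep ind1 ind2 (e ` J)"
    using J common_pull by (auto simp: max_common_indep_def)
  have "card K \<le> card (e ` J)" if K: "common_indep ind1 ind2 K" for K
  proof -
    have "K \<subseteq> e ` {..<n}"
      using K matroid.indep_subset_ground[OF m] image by (auto simp: common_indep_def)
    then obtain L where L: "L \<subseteq> {..<n}" "K = e ` L" by (auto simp: subset_image_iff)
    then have "card L \<le> card J"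
      using J K common_pull by (auto simp: max_common_indep_def)
    then show ?thesis using L Jn card_image_e by simp
  qed
  then show ?thesis using Jn by (simp add: max_common_indep_def decode_eq)
qed

end

section \<open>The bound in terms of the maximum common size\<close>

lemma card_le_max_common_size:
  assumes "matroid E ind1" "common_indep ind1 ind2 I"
  shows "card I \<le> max_common_size ind1 ind2"
proof -
  interpret matroid E ind1 by fact
  have "{card I |I. common_indep ind1 ind2 I} \<subseteq> {..card E}"
    using card_mono[OF finite_ground] indep_subset_ground by (auto simp: common_indep_def)
  then have "finite {card I |I. common_indep ind1 ind2 I}" using finite_subset by blast
  then show ?thesis unfolding max_common_size_def using assms(2) by (intro Max_ge) auto
qed

theorem theorem3p4:
  "\<exists>(P :: com) (c :: nat).
     \<forall>(E :: 'a set) (n :: nat) (indep\<^sub>1 :: 'a set \<Rightarrow> bool) (indep\<^sub>2 :: 'a set \<Rightarrow> bool)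
      (e :: nat \<Rightarrow> 'a).
       finite E \<and> card E = n \<and> bij_betw e {..<n} E \<and>
       matroid E indep\<^sub>1 \<and> loopless E indep\<^sub>1 \<and> matroid E indep\<^sub>2 \<and> loopless E indep\<^sub>2 \<longrightarrow>
       (\<exists>t s. exec (\<lambda>X. min_rank indep\<^sub>1 indep\<^sub>2 (decode e n X)) P (init_state n) t s \<and>
              max_common_indep indep\<^sub>1 indep\<^sub>2 (decode e n (result_set s)) \<and>
              (n \<noteq> 0 \<longrightarrow> t \<le> c * (max_common_size indep\<^sub>1 indep\<^sub>2 * n\<^sup>2)))"
proof (rule exI[of _ main], rule exI[of _ 5000], intro allI impI)
  fix E :: "'a set" and n ind1 ind2 e
  assume "finite E \<and> card E = n \<and> bij_betw e {..<n} E \<and>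
    matroid E ind1 \<and> loopless E ind1 \<and> matroid E ind2 \<and> loopless E ind2"
  then have bij: "bij_betw e {..<n} E" and m: "matroid E ind1" "matroid E ind2"
    and loopless: "loopless E ind1" "loopless E ind2" by auto
  let ?f = "\<lambda>X. min_rank ind1 ind2 (decode e n X)" and ?R = "max_common_size ind1 ind2"
  interpret numbered e n E by unfold_locales (rule bij)
  have empty: "common_indep (pull ind1) (pull ind2) {}"
    using m by (simp add: common_indep_def pull_def matroid.indep_empty)
  have size: "card J \<le> ?R" if "common_indep (pull ind1) (pull ind2) J" for J
    using that common_pull card_image_e card_le_max_common_size[OF m(1)] by metis
  have "run ?f main (init_state n) ((?R - card ({} :: nat set) + 1) * (500 * (n + 1)\<^sup>2 + 4) + 4)
      (\<lambda>s'. \<exists>J. arr s' aI = indic J \<and> max_common_indep (pull ind1) (pull ind2) J)"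
    by (rule run_main[OF matroid_pair_pull[OF m] _ _ _ empty size])
      (auto simp: init_state_def indic_def fun_eq_iff)
  then obtain t s J where run: "exec ?f main (init_state n) t s"
    "t \<le> (?R + 1) * (500 * (n + 1)\<^sup>2 + 4) + 4" "arr s aI = indic J"
    "max_common_indep (pull ind1) (pull ind2) J"
    unfolding run_def by auto
  have "result_set s = J" using run(3) by (simp add: result_set_def)
  then have "max_common_indep ind1 ind2 (decode e n (result_set s))"
    using max_common_pull[OF m(1) run(4)] by simp
  moreover have "t \<le> 5000 * (?R * n\<^sup>2)" if n: "n \<noteq> 0"
  proof -
    have "e 0 \<in> E" using n image by auto
    then have "common_indep ind1 ind2 {e 0}"
      using loopless by (simp add: loopless_def common_indep_def)
    \<comment> \<open>Looplessness makes a single element common independent, so the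
      \<open>?R + 1\<close> phases are at most \<open>2 * ?R\<close>.\<close>
    then have R: "1 \<le> ?R" using card_le_max_common_size[OF m(1)] by fastforce
    have "(n + 1)\<^sup>2 \<le> (2 * n)\<^sup>2" using n by (intro power_mono) auto
    \<comment> \<open>From \<open>n + 1 \<le> 2 * n\<close> one phase costs at most 2000 + 4 times
      the square of \<open>n\<close>. Doubling for the phases gives 4008, and the last 4 steps fit
      under 5000.\<close>
    then have "500 * (n + 1)\<^sup>2 + 4 \<le> 2004 * n\<^sup>2" using n by (simp add: power2_eq_square)
    then have "(?R + 1) * (500 * (n + 1)\<^sup>2 + 4) \<le> (2 * ?R) * (2004 * n\<^sup>2)"
      using R by (intro mult_le_mono) auto
    also have "\<dots> = 4008 * (?R * n\<^sup>2)" by simp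
    finally have "(?R + 1) * (500 * (n + 1)\<^sup>2 + 4) \<le> 4008 * (?R * n\<^sup>2)" .
    moreover have "1 * 1 \<le> ?R * n\<^sup>2" using n R by (intro mult_le_mono) auto
    ultimately show ?thesis using run(2) by linarith
  qed
  ultimately show "\<exists>t s. exec ?f main (init_state n) t s \<and>
      max_common_indep ind1 ind2 (decode e n (result_set s)) \<and>
      (n \<noteq> 0 \<longrightarrow> t \<le> 5000 * (?R * n\<^sup>2))"
    using run(1) by blast
qed

end
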